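(* For any constant $\eta\in(\mu,1)$ there is an efficient algorithm that, given a weighted instance $H=(V,E,w,\mu)$ of $\leq{\sf D}k{\sf SH}$ of arity $r$ with arbitrary vertex weights, returns a labeling $\tilde\pi:V\to\{0,1\}$ of relative weight at most $\mu(1+\eta)$ satisfying \[{\sf Val}_{\tilde\pi}(H)\gtrsim_r\big(\eta^r\alpha^{\sf uw}_{(\mu)}({\sf D}k{\sf SH}_r)\big)\cdot{\sf Val}_{\leq\mu}(H).\]
   Context: A $\leq{\sf D}k{\sf SH}$ instance $H=(V,E,w,\mu)$ of arity $r$ consists of a vertex set $V$, a multiset $E$ of $r$-element hyperedges, nonnegative vertex weights $w$, and $\mu\in(0,1)$. A labeling $\sigma:V\to\{0,1\}$ has relative weight $\sum_{\sigma(i)=1}w(i)/\sum_iw(i)$ and value ${\sf Val}_\sigma(H)=\Pr_{e\sim E}[\sigma(e)=\mathbf 1]$ (fraction of hyperedges all of whose vertices are labeled $1$); ${\sf Val}_{\leq\mu}(H)$ is the maximum value over labelings of relative weight at most $\mu$. ${\sf D}k{\sf SH}_r$: given an unweighted $r$-uniform hypergraph and $k=\mu|V|$, find $S$ with $|S|=k$ maximizing the fraction of hyperedges inside $S$; $\alpha^{\sf uw}_{(\mu)}({\sf D}k{\sf SH}_r)$ is the best polynomial-time approximation factor for such uniformly weighted instances. $A\gtrsim_rB$ means $A\geq c_rB$ for some $c_r>0$ depending only on $r$. *)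

theory Defs
  imports Complex_Main "HOL-Library.Multiset" "HOL-Library.Log_Nat"
    "HOL-Computational_Algebra.Polynomial"
begin

section \<open>Computation model\<close>

text \<open>
  Polynomial time is defined by a deterministic while-language on binary trees with natural
  numbers at the leaves. Cost is logarithmic: each step is charged the bit size of the data it
  reads and writes, so running times are polynomially related to those of Turing machines.
  The tree \<open>Atom 0\<close> also serves as the truth value false and as the empty list.
\<close>

datatype tree = Atom nat | Node tree tree

fun tree_size :: "tree \<Rightarrow> nat" where
  "tree_size (Atom n) = 1 + floorlog 2 n"
| "tree_size (Node a b) = 1 + tree_size a + tree_size b"

datatype prim = Id | Const nat | Left | Right | IsAtom | Add | Sub | Mul | Div

text \<open>Subtraction is truncated, and primitives applied to an argument of the wrong shape return
  \<open>Atom 0\<close>.\<close>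

fun apply_prim :: "prim \<Rightarrow> tree \<Rightarrow> tree" where
  "apply_prim Id x = x"
| "apply_prim (Const n) x = Atom n"
| "apply_prim Left (Node a b) = a"
| "apply_prim Right (Node a b) = b"
| "apply_prim IsAtom (Atom n) = Atom 1"
| "apply_prim Add (Node (Atom m) (Atom n)) = Atom (m + n)"
| "apply_prim Sub (Node (Atom m) (Atom n)) = Atom (m - n)"
| "apply_prim Mul (Node (Atom m) (Atom n)) = Atom (m * n)"
| "apply_prim Div (Node (Atom m) (Atom n)) = Atom (m div n)"
| "apply_prim _ _ = Atom 0"

datatype prog =
    Prim prim
  | Fork prog prog
  | Seq prog prog
  | Cond prog prog prog
  | While prog prog

text \<open>\<open>exec f x t y\<close>: program \<open>f\<close>, started on input \<open>x\<close>, halts with output \<open>y\<close> at total cost \<open>t\<close>.\<close>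

inductive exec :: "prog \<Rightarrow> tree \<Rightarrow> nat \<Rightarrow> tree \<Rightarrow> bool" where
  Prim: "exec (Prim p) x (1 + tree_size x + tree_size (apply_prim p x)) (apply_prim p x)"
| Fork: "exec f x t y \<Longrightarrow> exec g x u z \<Longrightarrow> exec (Fork f g) x (1 + tree_size x + t + u) (Node y z)"
| Seq: "exec f x t y \<Longrightarrow> exec g y u z \<Longrightarrow> exec (Seq f g) x (1 + t + u) z"
| CondT: "exec c x t b \<Longrightarrow> b \<noteq> Atom 0 \<Longrightarrow> exec f x u y \<Longrightarrow>
    exec (Cond c f g) x (1 + tree_size x + t + u) y"
| CondF: "exec c x t (Atom 0) \<Longrightarrow> exec g x u y \<Longrightarrow>
    exec (Cond c f g) x (1 + tree_size x + t + u) y"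
| WhileT: "exec c x t b \<Longrightarrow> b \<noteq> Atom 0 \<Longrightarrow> exec f x u y \<Longrightarrow> exec (While c f) y v z \<Longrightarrow>
    exec (While c f) x (1 + tree_size x + t + u + v) z"
| WhileF: "exec c x t (Atom 0) \<Longrightarrow> exec (While c f) x (1 + tree_size x + t) x"

inductive_cases exec_PrimE: "exec (Prim p) x t y"
inductive_cases exec_ForkE: "exec (Fork f g) x t y"
inductive_cases exec_SeqE: "exec (Seq f g) x t y"
inductive_cases exec_CondE: "exec (Cond c f g) x t y"
inductive_cases exec_WhileE: "exec (While c f) x t y"

lemma exec_deterministic:
  assumes "exec f x t y" and "exec f x t' y'"
  shows "t' = t \<and> y' = y"
  using assms
proof (induction arbitrary: t' y' rule: exec.induct)
  case (Prim p x)
  then show ?case by (auto elim: exec_PrimE)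
next
  case (Fork f x t y g u z)
  from Fork.prems show ?case by (rule exec_ForkE) (use Fork.IH in \<open>metis plus_1_eq_Suc add_Suc\<close>)
next
  case (Seq f x t y g u z)
  from Seq.prems show ?case by (rule exec_SeqE) (use Seq.IH in \<open>metis plus_1_eq_Suc add_Suc\<close>)
next
  case (CondT c x t b f u y g)
  from CondT.prems show ?case
    by (rule exec_CondE) (use CondT.IH CondT.hyps in \<open>metis plus_1_eq_Suc add_Suc\<close>)+
next
  case (CondF c x t g u y f)
  from CondF.prems show ?case
    by (rule exec_CondE) (use CondF.IH in \<open>metis plus_1_eq_Suc add_Suc\<close>)+
next
  case (WhileT c x t b f u y v z)
  from WhileT.prems show ?case
    by (rule exec_WhileE) (use WhileT.IH WhileT.hyps in \<open>metis plus_1_eq_Suc add_Suc\<close>)+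
next
  case (WhileF c x t f)
  from WhileF.prems show ?case
    by (rule exec_WhileE) (use WhileF.IH in \<open>metis plus_1_eq_Suc add_Suc\<close>)+
qed

lemma exec_output_size: "exec f x t y \<Longrightarrow> tree_size y \<le> t"
  by (induction rule: exec.induct) auto

text \<open>\<open>enc i x\<close>: the tree \<open>x\<close> is an encoding of the (valid) instance \<open>i\<close>.
  \<open>sol i y\<close>: the tree \<open>y\<close> is an acceptable output for \<open>i\<close>.\<close>

definition solves_in_poly_time ::
    "prog \<Rightarrow> ('i \<Rightarrow> tree \<Rightarrow> bool) \<Rightarrow> ('i \<Rightarrow> tree \<Rightarrow> bool) \<Rightarrow> bool" where
  "solves_in_poly_time A enc sol \<longleftrightarrow>
     (\<exists>p :: nat poly. \<forall>i x. enc i x \<longrightarrow>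
        (\<exists>t y. exec A x t y \<and> t \<le> poly p (tree_size x) \<and> sol i y))"


section \<open>Hypergraphs and weighted instances\<close>

text \<open>The vertex set is \<open>{..<num_verts G}\<close>.\<close>

record hypergraph =
  num_verts :: nat
  hyperedges :: "nat set multiset"

text \<open>Weights and bias are rational since they are part of the input of an algorithm.\<close>

record dksh_instance = hypergraph +
  weight :: "nat \<Rightarrow> rat"
  bias :: rat

definition uniform :: "nat \<Rightarrow> 'a hypergraph_scheme \<Rightarrow> bool" where
  "uniform r G \<longleftrightarrow> (\<forall>e \<in># hyperedges G. e \<subseteq> {..<num_verts G} \<and> card e = r)"

definition is_instance :: "nat \<Rightarrow> dksh_instance \<Rightarrow> bool" where
  "is_instance r H \<longleftrightarrow>
     uniform r H \<and> (\<forall>i < num_verts H. 0 \<le> weight H i) \<and> 0 < bias H \<and> bias H < 1"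

text \<open>A labeling by \<open>{0,1}\<close> is a predicate on vertices, with \<open>True\<close> for the label 1.\<close>

definition Val :: "'a hypergraph_scheme \<Rightarrow> (nat \<Rightarrow> bool) \<Rightarrow> real" where
  "Val G \<sigma> = real (size {#e \<in># hyperedges G. \<forall>i\<in>e. \<sigma> i#}) / real (size (hyperedges G))"

definition rel_weight :: "dksh_instance \<Rightarrow> (nat \<Rightarrow> bool) \<Rightarrow> rat" where
  "rel_weight H \<sigma> =
     (\<Sum>i \<in> {i. i < num_verts H \<and> \<sigma> i}. weight H i) / (\<Sum>i<num_verts H. weight H i)"

definition Val_le :: "rat \<Rightarrow> dksh_instance \<Rightarrow> real" where
  "Val_le \<mu> H = Max {Val H \<sigma> |\<sigma>. rel_weight H \<sigma> \<le> \<mu>}"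


section \<open>Encodings\<close>

definition enc_list :: "tree list \<Rightarrow> tree" where
  "enc_list xs = foldr Node xs (Atom 0)"

text \<open>Only used for nonnegative arguments.\<close>

definition enc_rat :: "rat \<Rightarrow> tree" where
  "enc_rat q = (case quotient_of q of (a, b) \<Rightarrow> Node (Atom (nat a)) (Atom (nat b)))"

text \<open>Hyperedges, and the vertices within each of them, may be listed in any order.\<close>

definition enc_edges :: "nat set multiset \<Rightarrow> tree \<Rightarrow> bool" where
  "enc_edges E x \<longleftrightarrow>
     (\<exists>es. mset (map set es) = E \<and> (\<forall>e \<in> set es. distinct e) \<and>
           x = enc_list (map (\<lambda>e. enc_list (map Atom e)) es))"

definition enc_labeling :: "nat \<Rightarrow> (nat \<Rightarrow> bool) \<Rightarrow> tree" where
  "enc_labeling n \<sigma> = enc_list (map (\<lambda>i. Atom (if \<sigma> i then 1 else 0)) [0..<n])"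

definition enc_instance :: "dksh_instance \<Rightarrow> tree \<Rightarrow> bool" where
  "enc_instance H x \<longleftrightarrow>
     (\<exists>es. enc_edges (hyperedges H) es \<and>
       x = Node (enc_list (map (\<lambda>i. enc_rat (weight H i)) [0..<num_verts H]))
             (Node es (enc_rat (bias H))))"

text \<open>The vertices are listed explicitly, so that the input is at least as long as a solution.\<close>

definition enc_unweighted :: "hypergraph \<times> nat \<Rightarrow> tree \<Rightarrow> bool" where
  "enc_unweighted = (\<lambda>(G, k) x.
     (\<exists>es. enc_edges (hyperedges G) es \<and>
       x = Node (enc_list (map Atom [0..<num_verts G])) (Node es (Atom k))))"


section \<open>Approximability of the uniformly weighted problem\<close>

definition DkSH_opt :: "hypergraph \<Rightarrow> nat \<Rightarrow> real" where
  "DkSH_opt G k = Max {Val G (\<lambda>i. i \<in> S) |S. S \<subseteq> {..<num_verts G} \<and> card S = k}"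

definition approximates_DkSH :: "prog \<Rightarrow> rat \<Rightarrow> nat \<Rightarrow> real \<Rightarrow> bool" where
  "approximates_DkSH B \<mu> r a \<longleftrightarrow>
     solves_in_poly_time B
       (\<lambda>(G, k) x. uniform r G \<and> of_nat k = \<mu> * of_nat (num_verts G) \<and> enc_unweighted (G, k) x)
       (\<lambda>(G, k) y. \<exists>S \<subseteq> {..<num_verts G}. card S = k \<and>
          y = enc_labeling (num_verts G) (\<lambda>i. i \<in> S) \<and>
          Val G (\<lambda>i. i \<in> S) \<ge> a * DkSH_opt G k)"

definition alpha_uw :: "rat \<Rightarrow> nat \<Rightarrow> real" where
  "alpha_uw \<mu> r = Sup {a. 0 \<le> a \<and> a \<le> 1 \<and> (\<exists>B. approximates_DkSH B \<mu> r a)}"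

end

theory Submission
  imports Defs
begin

text \<open>
  Let \<open>\<mu> = a/b\<close> and \<open>h = \<lceil>1/\<eta>\<rceil>\<close>. Replace vertex \<open>i\<close> of an instance on \<open>n\<close> vertices of total weight \<open>W\<close>
  by a cloud of \<open>n\<^sub>i = \<lfloor>w\<^sub>i b n / W\<rfloor> + 1\<close> copies inside a vertex set of size \<open>Q = 2bn\<close> (the remaining
  vertices are isolated), discard every hyperedge heavier than \<open>\<mu>W\<close>, and replace each other
  hyperedge by \<open>Q\<^sup>r\<close> hyperedges through all combinations of copies, each cloud being read cyclically
  through \<open>Q\<close> slots. With \<open>k = 2an\<close> every labeling of relative weight at most \<open>\<mu>\<close> lifts to a set of
  size \<open>k\<close> without loss of value.

  A set \<open>S\<close> of size \<open>k\<close> gives the fractional labeling \<open>x\<^sub>i\<close>, the fraction of slots of \<open>i\<close> that lie in \<open>S\<close>.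
  Label \<open>i\<close> by 1 independently with probability \<open>x\<^sub>i/(8h)\<close>. Conditioned on \<open>e\<close> being labeled 1, the expected
  weight outside \<open>e\<close> is at most half of \<open>\<mu>W/h\<close>, so the expectation of
  \<open>\<Sum>\<^sub>e [e labeled 1] (1 - (weight outside e) h / (\<mu>W))\<close> is at least \<open>(8h)\<^sup>-\<^sup>r/2\<close> times the fractional value.
  This potential is multi-affine, so the method of conditional expectations finds a labeling that
  does as well. If the potential is positive, some term is, and that hyperedge of weight at most
  \<open>\<mu>W\<close> certifies that the whole labeling weighs at most \<open>\<mu>(1 + \<eta>)W\<close>.
\<close>

section \<open>Polynomial-time functions on encoded data\<close>

class encodable =
  fixes encode :: "'a \<Rightarrow> tree"

instantiation nat :: encodable
begin
definition "encode (n::nat) = Atom n"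
instance ..
end

instantiation bool :: encodable
begin
definition "encode (b::bool) = Atom (if b then 1 else 0)"
instance ..
end

instantiation prod :: (encodable, encodable) encodable
begin
definition "encode (p::'a \<times> 'b) = Node (encode (fst p)) (encode (snd p))"
instance ..
end

instantiation list :: (encodable) encodable
begin
definition "encode (xs::'a list) = enc_list (map encode xs)"
instance ..
end

abbreviation esize :: "'a::encodable \<Rightarrow> nat" where
  "esize x \<equiv> tree_size (encode x)"

text \<open>\<open>f\<close> is total on its type, so no set of valid inputs has to be carried along
  and closure under composition has no side conditions.\<close>

definition poly_time :: "('a::encodable \<Rightarrow> 'b::encodable) \<Rightarrow> bool" where
  "poly_time f \<longleftrightarrow>
     (\<exists>A (p::nat poly). \<forall>x. \<exists>t. exec A (encode x) t (encode (f x)) \<and> t \<le> poly p (esize x))"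

text \<open>Coefficients in the naturals make every polynomial monotone, so a bound on an argument
  can be substituted into a cost bound.\<close>

lemma poly_nat_mono: "m \<le> n \<Longrightarrow> poly p m \<le> poly (p::nat poly) n"
  by (induction p) (auto intro!: add_mono mult_mono)

lemma encode_Nil [simp]: "encode [] = Atom 0"
  by (simp add: encode_list_def enc_list_def)

lemma encode_Cons [simp]: "encode (x # xs) = Node (encode x) (encode xs)"
  by (simp add: encode_list_def enc_list_def)

lemma encode_Pair [simp]: "encode (x, y) = Node (encode x) (encode y)"
  by (simp add: encode_prod_def)

section \<open>Bit lengths under arithmetic\<close>

lemma floorlog_zero [simp]: "floorlog b 0 = 0"
  by (simp add: floorlog_def)

lemma floorlog_two_le_iff: "floorlog 2 n \<le> w \<longleftrightarrow> n < 2 ^ w"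
  by (simp add: floorlog_le_iff)

lemma less_two_power_floorlog: "n < 2 ^ floorlog 2 n"
  using floorlog_two_le_iff by blast

lemma floorlog_two_mono: "m \<le> n \<Longrightarrow> floorlog 2 m \<le> floorlog 2 n"
  by (simp add: floorlog_mono)

lemma floorlog_two_le: "floorlog 2 n \<le> n"
  by (simp add: floorlog_two_le_iff)

lemma floorlog_two_mult: "floorlog 2 (m * n) \<le> floorlog 2 m + floorlog 2 n"
  unfolding floorlog_two_le_iff power_add
  by (intro mult_strict_mono less_two_power_floorlog) auto

lemma floorlog_two_add: "floorlog 2 (m + n) \<le> 1 + floorlog 2 m + floorlog 2 n"
proof -
  have "m + n < 2 ^ floorlog 2 m + 2 ^ floorlog 2 n"
    by (intro add_strict_mono less_two_power_floorlog)
  also have "\<dots> \<le> 2 ^ (floorlog 2 m + floorlog 2 n) + (2::nat) ^ (floorlog 2 m + floorlog 2 n)"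
    by (intro add_mono power_increasing) auto
  finally show ?thesis
    unfolding floorlog_two_le_iff by simp
qed

lemma tree_size_pos: "tree_size x \<ge> 1"
  by (cases x) auto

text \<open>Sizes are bit lengths, so even \<open>Mul\<close> yields no more bits than its two
  factors together; only \<open>Const n\<close> brings in bits of its own.\<close>

lemma tree_size_apply_prim:
  "tree_size (apply_prim p x) \<le> tree_size x + (case p of Const n \<Rightarrow> floorlog 2 n | _ \<Rightarrow> 0) + 1"
proof -
  have sub: "floorlog 2 (m - n) \<le> floorlog 2 m + k" for m n k :: nat
    using floorlog_two_mono[of "m - n" m] by simp
  have dv: "floorlog 2 (m div n) \<le> floorlog 2 m + k" for m n k :: nat
    using floorlog_two_mono[of "m div n" m] by simp
  have one: "floorlog 2 (Suc 0) = Suc 0"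
    by (simp add: floorlog_def)
  show ?thesis
    using tree_size_pos[of x]
    by (cases "(p, x)" rule: apply_prim.cases)
      (auto simp: one intro: le_trans[OF floorlog_two_add] le_trans[OF floorlog_two_mult]
        le_trans[OF sub[where k = 0]] le_trans[OF dv[where k = 0]])
qed

lemma poly_timeI:
  assumes "\<And>x. \<exists>t. exec A (encode x) t (encode (f x)) \<and> t \<le> poly p (esize x)"
  shows "poly_time f"
  using assms unfolding poly_time_def by blast

text \<open>Every step is charged for what it writes, so the running time also bounds the size of
  the output.\<close>

lemma poly_time_output_size:
  assumes "poly_time f"
  obtains p :: "nat poly" where "\<And>x. esize (f x) \<le> poly p (esize x)"
  using assms exec_output_size unfolding poly_time_def by (meson le_trans)

named_theorems poly_time_intros

section \<open>Closure of polynomial time under composition, pairing, arithmetic and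
  branching\<close>

lemma poly_time_compose:
  assumes f: "poly_time f" and g: "poly_time g"
  shows "poly_time (\<lambda>x. f (g x))"
proof -
  from f obtain A p where A: "\<And>x. \<exists>t. exec A (encode x) t (encode (f x)) \<and> t \<le> poly p (esize x)"
    unfolding poly_time_def by blast
  from g obtain B q where B: "\<And>x. \<exists>t. exec B (encode x) t (encode (g x)) \<and> t \<le> poly q (esize x)"
    unfolding poly_time_def by blast
  show ?thesis
  proof (rule poly_timeI[of "Seq B A" _ "[:1:] + q + pcompose p q"])
    fix x
    from B obtain t where t: "exec B (encode x) t (encode (g x))" "t \<le> poly q (esize x)" by blast
    from A obtain u where u: "exec A (encode (g x)) u (encode (f (g x)))" "u \<le> poly p (esize (g x))"
      by blast
    have "esize (g x) \<le> poly q (esize x)"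
      using exec_output_size[OF t(1)] t(2) by simp
    then have "u \<le> poly p (poly q (esize x))"
      using u(2) poly_nat_mono le_trans by blast
    then show "\<exists>t. exec (Seq B A) (encode x) t (encode (f (g x))) \<and>
        t \<le> poly ([:1:] + q + pcompose p q) (esize x)"
      using exec.Seq[OF t(1) u(1)] t(2) by (fastforce simp: poly_pcompose)
  qed
qed

lemma poly_time_id [poly_time_intros]: "poly_time (\<lambda>x. x)"
  by (rule poly_timeI[of "Prim Id" _ "[:1, 2:]"]) (use exec.Prim[of Id] in fastforce)

lemma poly_time_Pair [poly_time_intros]:
  assumes f: "poly_time f" and g: "poly_time g"
  shows "poly_time (\<lambda>x. (f x, g x))"
proof -
  from f obtain A p where A: "\<And>x. \<exists>t. exec A (encode x) t (encode (f x)) \<and> t \<le> poly p (esize x)"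
    unfolding poly_time_def by blast
  from g obtain B q where B: "\<And>x. \<exists>t. exec B (encode x) t (encode (g x)) \<and> t \<le> poly q (esize x)"
    unfolding poly_time_def by blast
  show ?thesis
  proof (rule poly_timeI[of "Fork A B" _ "[:1, 1:] + p + q"])
    fix x
    from A obtain t where t: "exec A (encode x) t (encode (f x))" "t \<le> poly p (esize x)" by blast
    from B obtain u where u: "exec B (encode x) u (encode (g x))" "u \<le> poly q (esize x)" by blast
    show "\<exists>t. exec (Fork A B) (encode x) t (encode (f x, g x)) \<and>
        t \<le> poly ([:1, 1:] + p + q) (esize x)"
      using exec.Fork[OF t(1) u(1)] t(2) u(2) by fastforce
  qed
qed

text \<open>Leaves come from \<open>Const\<close>, inner nodes from \<open>Fork\<close>; the
  discarded input contributes only its size to the cost.\<close>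

lemma exec_constant:
  "\<exists>A (p::nat poly). \<forall>x. \<exists>t. exec A x t c \<and> t \<le> poly p (tree_size x)"
proof (induction c)
  case (Atom n)
  show ?case
    by (rule exI[of _ "Prim (Const n)"], rule exI[of _ "[:2 + floorlog 2 n, 1:]"])
      (use exec.Prim[of "Const n"] in fastforce)
next
  case (Node a b)
  then obtain A B and p q :: "nat poly" where
    A: "\<And>x. \<exists>t. exec A x t a \<and> t \<le> poly p (tree_size x)" and
    B: "\<And>x. \<exists>t. exec B x t b \<and> t \<le> poly q (tree_size x)" by blast
  have "\<exists>t. exec (Fork A B) x t (Node a b) \<and> t \<le> poly ([:1, 1:] + p + q) (tree_size x)" for x
  proof -
    from A obtain t where t: "exec A x t a" "t \<le> poly p (tree_size x)" by blast
    from B obtain u where u: "exec B x u b" "u \<le> poly q (tree_size x)" by blast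
    show ?thesis
      using exec.Fork[OF t(1) u(1)] t(2) u(2) by fastforce
  qed
  then show ?case by blast
qed

lemma poly_time_const [poly_time_intros]: "poly_time (\<lambda>x. c)"
  using exec_constant[of "encode c"] unfolding poly_time_def by blast

lemma poly_time_prim:
  assumes "\<And>x. apply_prim P (encode x) = encode (f x)"
  shows "poly_time f"
proof (rule poly_timeI[of "Prim P" _ "[:2 + (case P of Const n \<Rightarrow> floorlog 2 n | _ \<Rightarrow> 0), 2:]"])
  fix x
  show "\<exists>t. exec (Prim P) (encode x) t (encode (f x)) \<and>
      t \<le> poly [:2 + (case P of Const n \<Rightarrow> floorlog 2 n | _ \<Rightarrow> 0), 2:] (esize x)"
    using exec.Prim[of P "encode x"] tree_size_apply_prim[of P "encode x"]
    unfolding assms by (intro exI[of _ "1 + esize x + esize (f x)"]) simp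
qed

lemma poly_time_fst [poly_time_intros]: "poly_time f \<Longrightarrow> poly_time (\<lambda>x. fst (f x))"
  by (rule poly_time_compose[of fst]) (auto intro!: poly_time_prim[of Left] simp: encode_prod_def)

lemma poly_time_snd [poly_time_intros]: "poly_time f \<Longrightarrow> poly_time (\<lambda>x. snd (f x))"
  by (rule poly_time_compose[of snd]) (auto intro!: poly_time_prim[of Right] simp: encode_prod_def)

lemma poly_time_binop:
  fixes h :: "nat \<Rightarrow> nat \<Rightarrow> nat"
  assumes "\<And>m n. apply_prim P (Node (Atom m) (Atom n)) = Atom (h m n)"
    and "poly_time f" "poly_time g"
  shows "poly_time (\<lambda>x. h (f x) (g x))"
proof -
  have "poly_time (\<lambda>p. h (fst p) (snd p))"
    by (rule poly_time_prim[of P]) (simp add: encode_prod_def encode_nat_def assms)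
  from poly_time_compose[OF this poly_time_Pair[OF assms(2,3)]] show ?thesis by simp
qed

lemma poly_time_add [poly_time_intros]:
  "poly_time f \<Longrightarrow> poly_time g \<Longrightarrow> poly_time (\<lambda>x. f x + g x :: nat)"
  by (rule poly_time_binop[of Add]) auto

lemma poly_time_diff [poly_time_intros]:
  "poly_time f \<Longrightarrow> poly_time g \<Longrightarrow> poly_time (\<lambda>x. f x - g x :: nat)"
  by (rule poly_time_binop[of Sub]) auto

lemma poly_time_mult [poly_time_intros]:
  "poly_time f \<Longrightarrow> poly_time g \<Longrightarrow> poly_time (\<lambda>x. f x * g x :: nat)"
  by (rule poly_time_binop[of Mul]) auto

lemma poly_time_div [poly_time_intros]:
  "poly_time f \<Longrightarrow> poly_time g \<Longrightarrow> poly_time (\<lambda>x. f x div g x :: nat)"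
  by (rule poly_time_binop[of Div]) auto

lemma poly_time_mod [poly_time_intros]:
  assumes "poly_time f" "poly_time g"
  shows "poly_time (\<lambda>x. f x mod g x :: nat)"
  unfolding modulo_nat_def by (intro poly_time_intros assms)

lemma poly_time_Cons [poly_time_intros]:
  assumes "poly_time f" "poly_time g"
  shows "poly_time (\<lambda>x. f x # g x)"
proof -
  \<comment> \<open>A pair and a list cell are both encoded by \<open>Node\<close>, so the program
    is the identity.\<close>
  have "poly_time (\<lambda>p. fst p # snd p)"
    by (rule poly_time_prim[of Id]) (simp add: encode_prod_def)
  from poly_time_compose[OF this poly_time_Pair[OF assms]] show ?thesis by simp
qed

lemma exec_Cond:
  assumes "exec C x t c" "c \<noteq> Atom 0 \<Longrightarrow> exec A x u y" "c = Atom 0 \<Longrightarrow> exec B x u y"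
  shows "exec (Cond C A B) x (1 + tree_size x + t + u) y"
  using assms exec.CondT exec.CondF by blast

lemma poly_time_If_nonzero:
  fixes c :: "'a::encodable \<Rightarrow> nat"
  assumes c: "poly_time c" and f: "poly_time f" and g: "poly_time g"
  shows "poly_time (\<lambda>x. if c x = 0 then g x else f x)"
proof -
  from c obtain C r where C: "\<And>x. \<exists>t. exec C (encode x) t (encode (c x)) \<and> t \<le> poly r (esize x)"
    unfolding poly_time_def by blast
  from f obtain A p where A: "\<And>x. \<exists>t. exec A (encode x) t (encode (f x)) \<and> t \<le> poly p (esize x)"
    unfolding poly_time_def by blast
  from g obtain B q where B: "\<And>x. \<exists>t. exec B (encode x) t (encode (g x)) \<and> t \<le> poly q (esize x)"
    unfolding poly_time_def by blast
  show ?thesis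
  proof (rule poly_timeI[of "Cond C A B" _ "[:1, 1:] + r + p + q"])
    fix x
    from A obtain t where t: "exec A (encode x) t (encode (f x))" "t \<le> poly p (esize x)" by blast
    from B obtain u where u: "exec B (encode x) u (encode (g x))" "u \<le> poly q (esize x)" by blast
    from C obtain v where v: "exec C (encode x) v (encode (c x))" "v \<le> poly r (esize x)" by blast
    have "exec (Cond C A B) (encode x) (1 + esize x + v + (if c x = 0 then u else t))
        (encode (if c x = 0 then g x else f x))"
      by (rule exec_Cond[OF v(1)]) (use t u in \<open>auto simp: encode_nat_def\<close>)
    then show "\<exists>t. exec (Cond C A B) (encode x) t (encode (if c x = 0 then g x else f x)) \<and>
        t \<le> poly ([:1, 1:] + r + p + q) (esize x)"
      using t(2) u(2) v(2)
      by (intro exI[of _ "1 + esize x + v + (if c x = 0 then u else t)"]) auto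
  qed
qed

text \<open>Truth values are encoded as the numbers 0 and 1, so a program for \<open>b\<close> is
  already a program for \<open>of_bool\<close>.\<close>

lemma poly_time_of_bool:
  assumes "poly_time b"
  shows "poly_time (\<lambda>x. of_bool (b x) :: nat)"
  using assms unfolding poly_time_def encode_bool_def encode_nat_def of_bool_def .

lemma poly_time_If [poly_time_intros]:
  assumes "poly_time b" "poly_time f" "poly_time g"
  shows "poly_time (\<lambda>x. if b x then f x else g x)"
proof -
  have "(\<lambda>x. if b x then f x else g x) = (\<lambda>x. if of_bool (b x) = (0::nat) then g x else f x)"
    by auto
  then show ?thesis
    using poly_time_If_nonzero[OF poly_time_of_bool[OF assms(1)] assms(2,3)] by simp
qed

lemma poly_time_nonzero:
  assumes "poly_time f"
  shows "poly_time (\<lambda>x. f x \<noteq> (0::nat))"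
proof -
  have "(\<lambda>x. f x \<noteq> 0) = (\<lambda>x. if f x = 0 then False else True)" by auto
  then show ?thesis
    using poly_time_If_nonzero[OF assms poly_time_const[of True] poly_time_const[of False]] by simp
qed

text \<open>Truncated subtraction decides the order: \<open>g x - f x\<close> is nonzero exactly
  when \<open>f x < g x\<close>.\<close>

lemma poly_time_less [poly_time_intros]:
  assumes "poly_time f" "poly_time g"
  shows "poly_time (\<lambda>x. f x < (g x::nat))"
  using poly_time_nonzero[OF poly_time_diff[OF assms(2,1)]] by (simp add: not_le)

lemma poly_time_Not [poly_time_intros]:
  assumes "poly_time b"
  shows "poly_time (\<lambda>x. \<not> b x)"
  using poly_time_If[OF assms poly_time_const[of False] poly_time_const[of True]]
  by (simp add: if_bool_eq_conj)

lemma poly_time_le [poly_time_intros]: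
  assumes "poly_time f" "poly_time g"
  shows "poly_time (\<lambda>x. f x \<le> (g x::nat))"
  unfolding not_less[symmetric] by (intro poly_time_intros assms)

lemma poly_time_eq [poly_time_intros]:
  assumes "poly_time f" "poly_time g"
  shows "poly_time (\<lambda>x. f x = (g x::nat))"
proof -
  have "(\<lambda>x. f x = g x) = (\<lambda>x. if f x \<le> g x then g x \<le> f x else False)" by auto
  then show ?thesis
    by (simp only:) (intro poly_time_intros assms)
qed

section \<open>Sizes of encoded lists\<close>

lemma length_le_esize: "length xs \<le> esize xs"
  by (induction xs) auto

lemma esize_le_esize_list: "x \<in> set xs \<Longrightarrow> esize x \<le> esize xs"
  by (induction xs) auto

lemma esize_list_le:
  "(\<And>x. x \<in> set xs \<Longrightarrow> esize x \<le> B) \<Longrightarrow> esize xs \<le> 1 + length xs * (1 + B)"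
proof (induction xs)
  case (Cons x xs)
  have "esize x \<le> B" "esize xs \<le> 1 + length xs * (1 + B)"
    using Cons by auto
  then show ?case by simp
qed simp

lemma esize_take_le: "esize (take j xs) \<le> esize xs"
proof (induction xs arbitrary: j)
  case (Cons x xs)
  then show ?case by (cases j) auto
qed simp

lemma esize_append: "esize (xs @ ys) + 1 = esize xs + esize ys"
  by (induction xs) auto

lemma esize_rev: "esize (rev xs) = esize xs"
proof (induction xs)
  case (Cons x xs)
  then show ?case using esize_append[of "rev xs" "[x]"] by simp
qed simp

section \<open>Folds over lists as while loops\<close>

lemma exec_Prim': "apply_prim p x = y \<Longrightarrow> exec (Prim p) x (1 + tree_size x + tree_size y) y"
  using exec.Prim by blast

text \<open>The loop state is the tree of \<open>(x, ys, s)\<close>: the context, the elements that remain to be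
  processed, and the accumulator.\<close>

definition fold_guard :: prog where
  "fold_guard = Cond (Seq (Prim Right) (Seq (Prim Left) (Prim IsAtom)))
     (Prim (Const 0)) (Prim (Const 1))"

text \<open>The step program \<open>G\<close> sees the state rearranged as \<open>(x, s, y)\<close>,
  where \<open>y\<close> is the head just removed from the list; its result becomes the new
  accumulator.\<close>

definition fold_body :: "prog \<Rightarrow> prog" where
  "fold_body G = Fork (Prim Left)
     (Fork (Seq (Prim Right) (Seq (Prim Left) (Prim Right)))
       (Seq (Fork (Prim Left) (Fork (Seq (Prim Right) (Prim Right))
               (Seq (Prim Right) (Seq (Prim Left) (Prim Left))))) G))"

lemma exec_fold_guard_Nil:
  "\<exists>t. exec fold_guard (Node x (Node (Atom 0) s)) t (Atom 0) \<and>
       t \<le> 20 * tree_size (Node x (Node (Atom 0) s)) + 20"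
  unfolding fold_guard_def
  by (rule exI, rule conjI, rule exec.CondT, (rule exec.Seq exec_Prim' apply_prim.simps)+,
      simp, (rule exec_Prim' apply_prim.simps)+) (simp add: floorlog_def)

lemma exec_fold_guard_Cons:
  "\<exists>t. exec fold_guard (Node x (Node (Node y ys) s)) t (Atom 1) \<and>
       t \<le> 20 * tree_size (Node x (Node (Node y ys) s)) + 20"
  unfolding fold_guard_def
  by (rule exI, rule conjI, rule exec.CondF, (rule exec.Seq exec_Prim' apply_prim.simps)+)
    (simp add: floorlog_def)

lemma exec_fold_body:
  assumes "exec G (Node x (Node s y)) t s'"
  shows "\<exists>u. exec (fold_body G) (Node x (Node (Node y ys) s)) u (Node x (Node ys s')) \<and>
       u \<le> 20 * tree_size (Node x (Node (Node y ys) s)) + 20 + t"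
  unfolding fold_body_def
  by (rule exI, rule conjI, (rule exec.Seq exec.Fork exec_Prim' apply_prim.simps assms)+)
    (simp add: floorlog_def)

text \<open>\<open>M\<close> bounds every loop state. In each round the guard and the rearrangement
  cost at most \<open>20 * M + 20\<close> each, the loop itself \<open>1 + M\<close> and the step
  \<open>poly p M\<close>. The last round is the failing test.\<close>

lemma exec_While_foldl:
  fixes g :: "'c::encodable \<Rightarrow> 's::encodable \<Rightarrow> 'e::encodable \<Rightarrow> 's"
  assumes G: "\<And>s y. \<exists>t. exec G (encode (x, s, y)) t (encode (g x s y)) \<and>
      t \<le> poly p (esize (x, s, y))"
    and bound: "\<And>j. j \<le> length ys \<Longrightarrow> esize (foldl (g x) s (take j ys)) \<le> B"
    and M: "esize x + esize ys + B + 2 \<le> M"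
  shows "\<exists>t. exec (While fold_guard (fold_body G)) (encode (x, ys, s)) t
      (encode (x, [] :: 'e list, foldl (g x) s ys)) \<and>
      t \<le> (length ys + 1) * (41 * M + 41 + poly p M)"
  using bound M
proof (induction ys arbitrary: s)
  case Nil
  have "tree_size (encode (x, [] :: 'e list, s)) \<le> M"
    using Nil(1)[of 0] Nil(2) by simp
  moreover obtain t where "exec fold_guard (encode (x, [] :: 'e list, s)) t (Atom 0)"
      "t \<le> 20 * tree_size (encode (x, [] :: 'e list, s)) + 20"
    using exec_fold_guard_Nil[of "encode x" "encode s"] by auto
  ultimately show ?case
    using exec.WhileF[of fold_guard "encode (x, [] :: 'e list, s)" t "fold_body G"]
    by (intro exI conjI) auto
next
  case (Cons y ys)
  let ?st = "encode (x, y # ys, s)"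
  have s: "esize s \<le> B" using Cons.prems(1)[of 0] by simp
  have size: "tree_size ?st \<le> M" "esize (x, s, y) \<le> M"
    using s Cons.prems(2) by simp_all
  obtain t where t: "exec fold_guard ?st t (Atom 1)" "t \<le> 20 * tree_size ?st + 20"
    using exec_fold_guard_Cons[of "encode x" "encode y" "encode ys" "encode s"] by auto
  obtain u where u: "exec G (encode (x, s, y)) u (encode (g x s y))" "u \<le> poly p (esize (x, s, y))"
    using G by blast
  have "u \<le> poly p M"
    using u(2) poly_nat_mono[OF size(2), of p] by simp
  obtain v where v: "exec (fold_body G) ?st v (encode (x, ys, g x s y))"
      "v \<le> 20 * tree_size ?st + 20 + u"
    using exec_fold_body[OF u(1)[simplified], of "encode ys"] by auto
  have "esize (foldl (g x) (g x s y) (take j ys)) \<le> B" if "j \<le> length ys" for j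
    using Cons.prems(1)[of "Suc j"] that by simp
  from Cons.IH[OF this] obtain w where w:
    "exec (While fold_guard (fold_body G)) (encode (x, ys, g x s y)) w
      (encode (x, [] :: 'e list, foldl (g x) (g x s y) ys))"
    "w \<le> (length ys + 1) * (41 * M + 41 + poly p M)"
    using Cons.prems(2) by auto
  have "exec (While fold_guard (fold_body G)) ?st (1 + tree_size ?st + t + v + w)
      (encode (x, [] :: 'e list, foldl (g x) s (y # ys)))"
    using exec.WhileT[OF t(1) _ v(1) w(1)] by simp
  moreover have "1 + tree_size ?st + t + v + w \<le> (length (y # ys) + 1) * (41 * M + 41 + poly p M)"
    using size t(2) v(2) w(2) \<open>u \<le> poly p M\<close> by simp
  ultimately show ?case by blast
qed

text \<open>Iterating a polynomial-time step may double the size in every round, as repeated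
  squaring does. A polynomial bound on all intermediate accumulators is therefore assumed.\<close>

lemma poly_time_foldl:
  fixes g :: "'c::encodable \<Rightarrow> 's::encodable \<Rightarrow> 'e::encodable \<Rightarrow> 's"
  assumes g: "poly_time (\<lambda>p. g (fst p) (fst (snd p)) (snd (snd p)))"
    and s: "poly_time s" and xs: "poly_time xs"
    and bound: "\<And>x j. j \<le> length (xs x) \<Longrightarrow>
      esize (foldl (g x) (s x) (take j (xs x))) \<le> poly q (esize x)"
  shows "poly_time (\<lambda>x. foldl (g x) (s x) (xs x))"
proof -
  from g obtain G p where "\<And>x. \<exists>t. exec G (encode x) t
      (encode (g (fst x) (fst (snd x)) (snd (snd x)))) \<and> t \<le> poly p (esize x)"
    unfolding poly_time_def by blast
  from this[of "(_, _, _)"] have G: "\<exists>t. exec G (encode (x, s, y)) t (encode (g x s y)) \<and>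
      t \<le> poly p (esize (x, s, y))" for x s y by simp
  have "poly_time (\<lambda>x. (x, xs x, s x))"
    by (intro poly_time_intros s xs)
  then obtain I i where I: "\<And>x. \<exists>t. exec I (encode x) t (encode (x, xs x, s x)) \<and> t \<le> poly i (esize x)"
    unfolding poly_time_def by blast
  \<comment> \<open>\<open>m\<close> bounds the loop states: \<open>i\<close> covers the context and
    the list, \<open>q\<close> the accumulator. \<open>b\<close> bounds the cost of
    \<open>P\<close>, with at most \<open>i + 1\<close> rounds.\<close>
  define m where "m = i + q + [:2:]"
  define P where "P = Seq I (While fold_guard (fold_body G))"
  define b where "b = [:1:] + i + (i + [:1:]) * ([:41:] * m + [:41:] + pcompose p m)"
  have "poly_time (\<lambda>x. (x, [] :: 'e list, foldl (g x) (s x) (xs x)))"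
  proof (rule poly_timeI[of P _ b])
    fix x
    obtain t where t: "exec I (encode x) t (encode (x, xs x, s x))" "t \<le> poly i (esize x)"
      using I by blast
    have size: "esize (x, xs x, s x) \<le> poly i (esize x)"
      using exec_output_size[OF t(1)] t(2) by simp
    then have len: "length (xs x) \<le> poly i (esize x)"
      using length_le_esize[of "xs x"] by simp
    have M: "esize x + esize (xs x) + poly q (esize x) + 2 \<le> poly m (esize x)"
      using size by (simp add: m_def)
    obtain u where u: "exec (While fold_guard (fold_body G)) (encode (x, xs x, s x)) u
        (encode (x, [] :: 'e list, foldl (g x) (s x) (xs x)))"
      "u \<le> (length (xs x) + 1) * (41 * poly m (esize x) + 41 + poly p (poly m (esize x)))"
      using exec_While_foldl[where x = x and g = g and ys = "xs x" and s = "s x", OF G bound M]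
      by blast
    note u(2)
    also have "\<dots> \<le> (poly i (esize x) + 1) *
        (41 * poly m (esize x) + 41 + poly p (poly m (esize x)))"
      using len by (intro mult_right_mono) auto
    finally have "1 + t + u \<le> poly b (esize x)"
      using t(2) by (simp add: b_def poly_pcompose)
    then show "\<exists>t. exec P (encode x) t (encode (x, [] :: 'e list, foldl (g x) (s x) (xs x))) \<and>
        t \<le> poly b (esize x)"
      using exec.Seq[OF t(1) u(1)] unfolding P_def by blast
  qed
  from poly_time_snd[OF poly_time_snd[OF this]] show ?thesis by simp
qed

text \<open>Pushing elements onto a list in a left fold reverses them. Appending then needs a
  reversal beforehand, mapping one afterwards.\<close>

lemma poly_time_rev_append:
  assumes "poly_time xs" "poly_time ys"
  shows "poly_time (\<lambda>x. rev (xs x) @ ys x)"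
proof -
  have eq: "foldl (\<lambda>s y. y # s) zs ys = rev ys @ zs" for ys zs :: "'b list"
    by (induction ys arbitrary: zs) auto
  obtain p where p: "\<And>x. esize (xs x) \<le> poly p (esize x)"
    using poly_time_output_size[OF assms(1)] by blast
  obtain q where q: "\<And>x. esize (ys x) \<le> poly q (esize x)"
    using poly_time_output_size[OF assms(2)] by blast
  have "poly_time (\<lambda>x. foldl (\<lambda>s y. y # s) (ys x) (xs x))"
  proof (rule poly_time_foldl[where g = "\<lambda>x s y. y # s" and q = "p + q"])
    fix x j
    have "esize (rev (take j (xs x)) @ ys x) \<le> esize (take j (xs x)) + esize (ys x)"
      using esize_append[of "rev (take j (xs x))" "ys x"] by (simp add: esize_rev)
    also have "\<dots> \<le> poly p (esize x) + poly q (esize x)"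
      using p[of x] q[of x] esize_take_le[of j "xs x"] by simp
    finally show "esize (foldl (\<lambda>s y. y # s) (ys x) (take j (xs x))) \<le> poly (p + q) (esize x)"
      by (simp add: eq)
  qed (intro poly_time_intros assms)+
  then show ?thesis by (simp add: eq)
qed

lemma poly_time_rev [poly_time_intros]: "poly_time xs \<Longrightarrow> poly_time (\<lambda>x. rev (xs x))"
  using poly_time_rev_append[OF _ poly_time_const[of "[]"]] by simp

lemma poly_time_append [poly_time_intros]:
  "poly_time xs \<Longrightarrow> poly_time ys \<Longrightarrow> poly_time (\<lambda>x. xs x @ ys x)"
  using poly_time_rev_append[OF poly_time_rev] by simp

lemma poly_time_map [poly_time_intros]:
  assumes f: "poly_time (\<lambda>p. f (fst p) (snd p))" and xs: "poly_time xs"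
  shows "poly_time (\<lambda>x. map (f x) (xs x))"
proof -
  have eq: "foldl (\<lambda>s y. f x y # s) zs ys = rev (map (f x) ys) @ zs" for x ys zs
    by (induction ys arbitrary: zs) auto
  obtain p where "\<And>x. esize (f (fst x) (snd x)) \<le> poly p (esize x)"
    using poly_time_output_size[OF f] by blast
  from this[of "(_, _)"] have p: "esize (f x y) \<le> poly p (esize (x, y))" for x y by simp
  obtain q where q: "\<And>x. esize (xs x) \<le> poly q (esize x)"
    using poly_time_output_size[OF xs] by blast
  \<comment> \<open>There are at most \<open>q\<close> results, each computed from a pair of the
    context and one element, whose size is at most \<open>1 + esize x + q\<close>.\<close>
  define b where "b = [:1:] + q * ([:1:] + pcompose p ([:1, 1:] + q))"
  have "poly_time (\<lambda>x. foldl (\<lambda>s y. f x y # s) [] (xs x))"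
  proof (rule poly_time_foldl[where g = "\<lambda>x s y. f x y # s" and q = b])
    fix x j
    let ?ys = "take j (xs x)"
    have "esize (f x y) \<le> poly p (1 + esize x + poly q (esize x))" if "y \<in> set ?ys" for y
    proof -
      have "esize y \<le> poly q (esize x)"
        using that esize_le_esize_list[of y "xs x"] q[of x] by (auto dest: in_set_takeD)
      then show ?thesis
        using p[of x y] poly_nat_mono[of "esize (x, y)" "1 + esize x + poly q (esize x)" p] by simp
    qed
    then have "esize (map (f x) ?ys) \<le>
        1 + length (map (f x) ?ys) * (1 + poly p (1 + esize x + poly q (esize x)))"
      by (intro esize_list_le) auto
    also have "\<dots> \<le> 1 + poly q (esize x) * (1 + poly p (1 + esize x + poly q (esize x)))"
      using q[of x] length_le_esize[of "xs x"] by (intro add_mono mult_right_mono) auto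
    finally show "esize (foldl (\<lambda>s y. f x y # s) [] ?ys) \<le> poly b (esize x)"
      by (simp add: eq esize_rev b_def poly_pcompose algebra_simps)
  qed (intro poly_time_intros xs
        poly_time_compose[OF f, of "\<lambda>p. (fst p, snd (snd p))", simplified])+
  from poly_time_rev[OF this] show ?thesis by (simp add: eq)
qed

lemma poly_time_concat [poly_time_intros]:
  assumes "poly_time xss"
  shows "poly_time (\<lambda>x. concat (xss x))"
proof -
  have eq: "foldl (@) zs ys = zs @ concat ys" for ys and zs :: "'b list"
    by (induction ys arbitrary: zs) auto
  have size: "esize (concat ys) \<le> esize ys" for ys :: "'b list list"
  proof (induction ys)
    case (Cons y ys)
    then show ?case using esize_append[of y "concat ys"] by simp
  qed simp
  obtain q where q: "\<And>x. esize (xss x) \<le> poly q (esize x)"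
    using poly_time_output_size[OF assms] by blast
  have "poly_time (\<lambda>x. foldl (@) [] (xss x))"
  proof (rule poly_time_foldl[where g = "\<lambda>x. (@)" and q = q])
    fix x j
    show "esize (foldl (@) [] (take j (xss x))) \<le> poly q (esize x)"
      using size[of "take j (xss x)"] esize_take_le[of j "xss x"] q[of x] by (simp add: eq)
  qed (intro poly_time_intros assms)+
  then show ?thesis by (simp add: eq)
qed

lemma poly_time_filter [poly_time_intros]:
  assumes P: "poly_time (\<lambda>p. P (fst p) (snd p))" and xs: "poly_time xs"
  shows "poly_time (\<lambda>x. filter (P x) (xs x))"
proof -
  have eq: "filter (P x) ys = concat (map (\<lambda>y. if P x y then [y] else []) ys)" for x ys
    by (induction ys) auto
  show ?thesis
    unfolding eq by (intro poly_time_intros P xs)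
qed

lemma poly_time_sum_list [poly_time_intros]:
  assumes "poly_time xs"
  shows "poly_time (\<lambda>x. sum_list (xs x) :: nat)"
proof -
  have eq: "foldl (+) z ys = z + sum_list ys" for ys and z :: nat
    by (induction ys arbitrary: z) auto
  have size: "esize (sum_list ys) \<le> esize ys" for ys :: "nat list"
  proof (induction ys)
    case (Cons y ys)
    then show ?case using floorlog_two_add[of y "sum_list ys"] by (simp add: encode_nat_def)
  qed (simp add: encode_nat_def)
  obtain q where q: "\<And>x. esize (xs x) \<le> poly q (esize x)"
    using poly_time_output_size[OF assms] by blast
  have "poly_time (\<lambda>x. foldl (+) 0 (xs x))"
  proof (rule poly_time_foldl[where g = "\<lambda>x. (+)" and q = q])
    fix x j
    show "esize (foldl (+) 0 (take j (xs x))) \<le> poly q (esize x)"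
      using size[of "take j (xs x)"] esize_take_le[of j "xs x"] q[of x] by (simp add: eq)
  qed (intro poly_time_intros assms)+
  then show ?thesis by (simp add: eq)
qed

text \<open>Bit lengths add up under multiplication, so every partial product has at most one bit
  more than the encoded list.\<close>

lemma poly_time_prod_list [poly_time_intros]:
  assumes "poly_time xs"
  shows "poly_time (\<lambda>x. prod_list (xs x) :: nat)"
proof -
  have eq: "foldl (*) z ys = z * prod_list ys" for ys and z :: nat
    by (induction ys arbitrary: z) auto
  have size: "esize (prod_list ys) \<le> 1 + esize ys" for ys :: "nat list"
  proof (induction ys)
    case (Cons y ys)
    then show ?case using floorlog_two_mult[of y "prod_list ys"] by (simp add: encode_nat_def)
  qed (simp add: encode_nat_def floorlog_def)
  obtain q where q: "\<And>x. esize (xs x) \<le> poly q (esize x)"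
    using poly_time_output_size[OF assms] by blast
  have "poly_time (\<lambda>x. foldl (*) 1 (xs x))"
  proof (rule poly_time_foldl[where g = "\<lambda>x. (*)" and q = "[:1:] + q"])
    fix x j
    show "esize (foldl (*) 1 (take j (xs x))) \<le> poly ([:1:] + q) (esize x)"
      using size[of "take j (xs x)"] esize_take_le[of j "xs x"] q[of x] by (simp add: eq)
  qed (intro poly_time_intros assms)+
  then show ?thesis by (simp add: eq)
qed

lemma poly_time_length [poly_time_intros]:
  assumes "poly_time xs"
  shows "poly_time (\<lambda>x. length (xs x))"
proof -
  have "poly_time (\<lambda>x. sum_list (map (\<lambda>y. 1::nat) (xs x)))"
    by (intro poly_time_intros assms)
  then show ?thesis by (simp add: sum_list_triv)
qed

lemma poly_time_enumerate [poly_time_intros]: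
  assumes "poly_time xs"
  shows "poly_time (\<lambda>x. List.enumerate 0 (xs x))"
proof -
  let ?step = "\<lambda>s y. (fst s + 1 :: nat, (fst s, y) # snd s)"
  have eq: "foldl ?step (m, zs) ys = (m + length ys, rev (List.enumerate m ys) @ zs)"
    for ys :: "'b list" and m :: nat and zs
    by (induction ys arbitrary: m zs) auto
  have num: "esize (m::nat) \<le> 1 + m" for m
    using floorlog_two_le[of m] by (simp add: encode_nat_def)
  obtain q where q: "\<And>x. esize (xs x) \<le> poly q (esize x)"
    using poly_time_output_size[OF assms] by blast
  \<comment> \<open>\<open>2 + q\<close> pays for the pair node and the counter, the rest for at
    most \<open>q\<close> entries of size at most \<open>2 + q + q\<close>.\<close>
  define b where "b = [:2:] + q + [:1:] + q * ([:3:] + q + q)"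
  have "poly_time (\<lambda>x. foldl ?step (0, []) (xs x))"
  proof (rule poly_time_foldl[where g = "\<lambda>x. ?step" and q = b])
    fix x j
    let ?ys = "take j (xs x)"
    have len: "length ?ys \<le> poly q (esize x)"
      using length_le_esize[of "xs x"] q[of x] by simp
    have "esize z \<le> 2 + poly q (esize x) + poly q (esize x)" if "z \<in> set (List.enumerate 0 ?ys)" for z
    proof -
      obtain i y where zz: "z = (i, y)" by (rule prod.exhaust)
      have z: "z = (i, y)" "i < length ?ys" "y \<in> set ?ys"
        using that zz nth_mem[of i ?ys] by (auto simp: in_set_enumerate_eq simp del: nth_mem nth_take)
      have "esize y \<le> poly q (esize x)"
        using z esize_le_esize_list[of y "xs x"] q[of x] by (auto dest: in_set_takeD)
      then show ?thesis
        using num[of i] less_le_trans[OF z(2) len] z(1) by simp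
    qed
    then have "esize (List.enumerate 0 ?ys) \<le>
        1 + length (List.enumerate 0 ?ys) * (1 + (2 + poly q (esize x) + poly q (esize x)))"
      by (rule esize_list_le)
    also have "\<dots> \<le> 1 + poly q (esize x) * (1 + (2 + poly q (esize x) + poly q (esize x)))"
      using len by (intro add_mono mult_right_mono) auto
    finally show "esize (foldl ?step (0, []) ?ys) \<le> poly b (esize x)"
      using num[of "length ?ys"] len
      by (simp only: eq encode_Pair tree_size.simps) (simp add: esize_rev b_def algebra_simps)
  qed (intro poly_time_intros assms)+
  note poly_time_rev[OF poly_time_snd[OF this]]
  moreover have "rev (snd (foldl ?step (0, []) ys)) = List.enumerate 0 ys" for ys :: "'b list"
    by (subst eq) simp
  ultimately show ?thesis by (simp only:)
qed

text \<open>\<open>k\<close> is fixed outside the program: each \<open>k\<close> has its own program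
  and polynomial, as it must, since the number of tuples is exponential in \<open>k\<close>.\<close>

lemma poly_time_n_lists [poly_time_intros]:
  assumes "poly_time xs"
  shows "poly_time (\<lambda>x. List.n_lists k (xs x))"
proof (induction k)
  case (Suc k)
  have "poly_time (\<lambda>x. concat (map (\<lambda>ys. map (\<lambda>y. y # ys) (xs x)) (List.n_lists k (xs x))))"
    by (intro poly_time_intros Suc poly_time_compose[OF assms])
  then show ?case by (simp only: n_lists.simps)
qed (simp only: n_lists.simps poly_time_const)

text \<open>Indexing that yields 0 beyond the end of the list, so that it is a total function.\<close>

definition lookup :: "nat list \<Rightarrow> nat \<Rightarrow> nat" where
  "lookup xs i = (\<Sum>(j, y) \<leftarrow> List.enumerate 0 xs. if j = i then y else 0)"

lemma poly_time_lookup [poly_time_intros]: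
  assumes "poly_time xs" "poly_time i"
  shows "poly_time (\<lambda>x. lookup (xs x) (i x))"
  unfolding lookup_def case_prod_unfold
  by (intro poly_time_intros assms poly_time_compose[OF assms(2)])

lemma poly_time_member [poly_time_intros]:
  assumes "poly_time i" "poly_time xs"
  shows "poly_time (\<lambda>x. i x \<in> set (xs x :: nat list))"
proof -
  have "poly_time (\<lambda>x. length (filter (\<lambda>z. z = i x) (xs x)))"
    by (intro poly_time_intros assms poly_time_compose[OF assms(1)])
  from poly_time_nonzero[OF this] show ?thesis
    by (simp add: filter_empty_conv)
qed

lemma sum_list_enumerate:
  "(\<Sum>z \<leftarrow> List.enumerate 0 xs. f z) = (\<Sum>i < length xs. f (i, xs ! i))"
proof -
  have "map f (List.enumerate 0 xs) = map (\<lambda>i. f (i, xs ! i)) [0..<length xs]"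
    by (rule nth_equalityI) (auto simp: nth_enumerate_eq)
  then show ?thesis
    by (simp add: interv_sum_list_conv_sum_set_nat atLeast0LessThan)
qed

lemma lookup_eq_nth: "i < length xs \<Longrightarrow> lookup xs i = xs ! i"
  by (simp add: lookup_def sum_list_enumerate)

lemma poly_time_list_update [poly_time_intros]:
  fixes xs :: "'c::encodable \<Rightarrow> 'e::encodable list"
  assumes "poly_time xs" "poly_time i" "poly_time v"
  shows "poly_time (\<lambda>x. (xs x)[i x := v x])"
proof -
  have eq: "ys[k := w] = map (\<lambda>p. if fst p = k then w else snd p) (List.enumerate 0 ys)"
    for ys :: "'e list" and k w
    by (rule nth_equalityI) (auto simp: nth_enumerate_eq nth_list_update)
  show ?thesis
    unfolding eq
    by (intro poly_time_intros assms poly_time_compose[OF assms(2)] poly_time_compose[OF assms(3)])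
qed

text \<open>An interval can be exponentially longer than the numeral of its endpoint, so intervals
  are only made from lists: \<open>k\<close> copies are joined and the indices of their enumeration
  kept.\<close>

lemma poly_time_upt_length:
  assumes "poly_time xs"
  shows "poly_time (\<lambda>x. [0..<k * length (xs x)])"
proof -
  have rep: "poly_time (\<lambda>x. concat (replicate k (xs x)))"
  proof (induction k)
    case (Suc k)
    then show ?case by (simp add: poly_time_append[OF assms])
  qed (simp add: poly_time_const)
  have "poly_time (\<lambda>x. map fst (List.enumerate 0 (concat (replicate k (xs x)))))"
    by (rule poly_time_map[OF _ poly_time_enumerate[OF rep]]) (intro poly_time_intros)
  then show ?thesis
    by (simp add: enumerate_eq_zip length_concat sum_list_replicate)
qed

lemma poly_time_indices:
  assumes "poly_time xs"
  shows "poly_time (\<lambda>x. [0..<length (xs x)])"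
  using poly_time_upt_length[OF assms, of 1] by simp

section \<open>The reduction to uniform weights\<close>

text \<open>A common denominator of all weights. The plain product avoids gcd computations and still
  has polynomial bit length.\<close>

definition denom_prod :: "(nat \<times> nat) list \<Rightarrow> nat" where
  "denom_prod ws = prod_list (map snd ws)"

definition int_weights :: "(nat \<times> nat) list \<Rightarrow> nat list" where
  "int_weights ws = map (\<lambda>w. fst w * (denom_prod ws div snd w)) ws"

text \<open>Floor plus one is at least the exact share of \<open>b * n\<close> copies and makes
  every cloud nonempty. The excess, at most one per vertex, is absorbed by the factor 2 in
  \<open>2 * b * n\<close>.\<close>

definition cloud_sizes :: "nat \<Rightarrow> (nat \<times> nat) list \<Rightarrow> nat list" where
  "cloud_sizes b ws =
     map (\<lambda>w. w * (b * length ws) div sum_list (int_weights ws) + 1) (int_weights ws)"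

definition offset :: "nat list \<Rightarrow> nat \<Rightarrow> nat" where
  "offset ns i = (\<Sum>p \<leftarrow> List.enumerate 0 ns. if fst p < i then snd p else 0)"

text \<open>Cloud \<open>i\<close> is the interval of length \<open>ns ! i\<close> starting at \<open>offset ns i\<close>; reducing the slot
  number \<open>t\<close> modulo its length gives all clouds the same number of slots.\<close>

definition cloud_copy :: "nat list \<Rightarrow> nat \<Rightarrow> nat \<Rightarrow> nat" where
  "cloud_copy ns i t = offset ns i + t mod lookup ns i"

text \<open>The inequality is w(e) \<le> \<mu> W for \<mu> = a/b, cleared of fractions. No labeling
  of relative weight at most \<mu> can contain a hyperedge that fails it.\<close>

definition light_edges :: "nat \<Rightarrow> nat \<Rightarrow> (nat \<times> nat) list \<Rightarrow> nat list list \<Rightarrow> nat list list" where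
  "light_edges a b ws es =
     filter (\<lambda>e. b * (\<Sum>i \<leftarrow> e. lookup (int_weights ws) i) \<le> a * sum_list (int_weights ws)) es"

text \<open>One list serves twice: as the slot numbers of each cloud and as the vertex list of the
  cloud graph.\<close>

definition slots :: "nat \<Rightarrow> 'a list \<Rightarrow> nat list" where
  "slots b ws = [0..<2 * b * length ws]"

definition cloud_edges :: "nat \<Rightarrow> nat \<Rightarrow> nat \<Rightarrow> (nat \<times> nat) list \<Rightarrow> nat list list \<Rightarrow> nat list list" where
  "cloud_edges r a b ws es =
     concat (map (\<lambda>e. map (\<lambda>ts. map (\<lambda>j. cloud_copy (cloud_sizes b ws) (lookup e j) (lookup ts j)) [0..<r])
       (List.n_lists r (slots b ws))) (light_edges a b ws es))"

text \<open>The entries of \<open>z\<close> are numerators of probabilities over a common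
  denominator \<open>Z\<close>, so this is \<open>Z ^ r\<close> times the probability that
  \<open>e\<close> is labeled 1.\<close>

definition edge_prod :: "nat list \<Rightarrow> nat list \<Rightarrow> nat" where
  "edge_prod z e = prod_list (map (lookup z) e)"

text \<open>Cloud sizes stand in for the weights. They dominate the true weights up to scaling and
  are what a set of vertices in the cloud graph controls.\<close>

definition outer_weight :: "nat list \<Rightarrow> nat list \<Rightarrow> nat list \<Rightarrow> nat" where
  "outer_weight ns z e =
     (\<Sum>p \<leftarrow> List.enumerate 0 ns. if fst p \<in> set e then 0 else snd p * lookup z (fst p))"

text \<open>\<open>gain\<close> and \<open>loss\<close> are the positive and the negative half of
  the scaled expected potential, kept apart so that the program computes in the naturals.\<close>

definition gain :: "nat \<Rightarrow> nat list list \<Rightarrow> nat list \<Rightarrow> nat" where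
  "gain A es z = (\<Sum>e \<leftarrow> es. edge_prod z e * A)"

definition loss :: "nat \<Rightarrow> nat list \<Rightarrow> nat list list \<Rightarrow> nat list \<Rightarrow> nat" where
  "loss h ns es z = (\<Sum>e \<leftarrow> es. edge_prod z e * (h * outer_weight ns z e))"

text \<open>Both sides of the comparison are moved so that no subtraction occurs.\<close>

definition round_step ::
    "nat \<Rightarrow> nat \<Rightarrow> nat \<Rightarrow> nat list \<Rightarrow> nat list list \<Rightarrow> nat list \<Rightarrow> nat \<Rightarrow> nat list" where
  "round_step A Z h ns es z i =
     (if gain A es (z[i := 0]) + loss h ns es (z[i := Z]) < gain A es (z[i := Z]) + loss h ns es (z[i := 0])
      then z[i := Z] else z[i := 0])"

definition slot_counts :: "nat \<Rightarrow> (nat \<times> nat) list \<Rightarrow> nat list \<Rightarrow> nat list" where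
  "slot_counts b ws bits =
     map (\<lambda>i. \<Sum>t \<leftarrow> slots b ws. lookup bits (cloud_copy (cloud_sizes b ws) i t)) [0..<length ws]"

text \<open>Since Z is \<open>8 * h\<close> times the number of slots, slot counts over Z are the
  fractions x/(8h): the damping lies in the denominator alone. The factor Z in the first argument of
  \<open>round_step\<close> matches the scale of \<open>outer_weight\<close>.\<close>

definition rounded :: "nat \<Rightarrow> nat \<Rightarrow> nat \<Rightarrow> (nat \<times> nat) list \<Rightarrow> nat list list \<Rightarrow> nat list \<Rightarrow> nat list" where
  "rounded a b h ws es bits =
     (let Z = 8 * h * (2 * b * length ws) in
      foldl (round_step (a * length ws * Z) Z h (cloud_sizes b ws) (light_edges a b ws es))
        (slot_counts b ws bits) [0..<length ws])"

text \<open>If all weights vanish, every relative weight is 0 because division by zero gives 0;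
  labeling everything 1 is then admissible and optimal.\<close>

definition decode :: "nat \<Rightarrow> nat \<Rightarrow> nat \<Rightarrow> (nat \<times> nat) list \<Rightarrow> nat list list \<Rightarrow> nat list \<Rightarrow> nat list" where
  "decode a b h ws es bits =
     (if sum_list (int_weights ws) = 0 then map (\<lambda>w. 1) ws
      else map (\<lambda>y. if y = 0 then 0 else 1) (rounded a b h ws es bits))"

section \<open>Polynomial time for the reduction and the rounding\<close>

lemma poly_time_denom_prod [poly_time_intros]:
  assumes "poly_time ws" shows "poly_time (\<lambda>x. denom_prod (ws x))"
  unfolding denom_prod_def by (intro poly_time_intros assms)

lemma poly_time_int_weights [poly_time_intros]:
  assumes "poly_time ws" shows "poly_time (\<lambda>x. int_weights (ws x))"
  unfolding int_weights_def by (intro poly_time_intros assms poly_time_compose[OF assms])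

lemma poly_time_cloud_sizes [poly_time_intros]:
  assumes "poly_time ws" shows "poly_time (\<lambda>x. cloud_sizes b (ws x))"
  unfolding cloud_sizes_def by (intro poly_time_intros assms poly_time_compose[OF assms])

lemma poly_time_cloud_copy [poly_time_intros]:
  assumes "poly_time ns" "poly_time i" "poly_time t"
  shows "poly_time (\<lambda>x. cloud_copy (ns x) (i x) (t x))"
  unfolding cloud_copy_def offset_def
  by (intro poly_time_intros assms poly_time_compose[OF assms(1)] poly_time_compose[OF assms(2)])

lemma poly_time_light_edges [poly_time_intros]:
  assumes "poly_time ws" "poly_time es"
  shows "poly_time (\<lambda>x. light_edges a b (ws x) (es x))"
  unfolding light_edges_def by (intro poly_time_intros assms poly_time_compose[OF assms(1)])

lemma poly_time_slots [poly_time_intros]: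
  assumes "poly_time ws" shows "poly_time (\<lambda>x. slots b (ws x))"
  unfolding slots_def by (intro poly_time_upt_length assms)

lemma poly_time_cloud_edges [poly_time_intros]:
  assumes "poly_time ws" "poly_time es"
  shows "poly_time (\<lambda>x. cloud_edges r a b (ws x) (es x))"
  unfolding cloud_edges_def by (intro poly_time_intros assms poly_time_compose[OF assms(1)])

lemma poly_time_gain [poly_time_intros]:
  assumes "poly_time A" "poly_time es" "poly_time z"
  shows "poly_time (\<lambda>x. gain (A x) (es x) (z x))"
  unfolding gain_def edge_prod_def
  by (intro poly_time_intros assms poly_time_compose[OF assms(1)] poly_time_compose[OF assms(3)])

lemma poly_time_loss [poly_time_intros]:
  assumes "poly_time ns" "poly_time es" "poly_time z"
  shows "poly_time (\<lambda>x. loss h (ns x) (es x) (z x))"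
  unfolding loss_def edge_prod_def outer_weight_def
  by (intro poly_time_intros assms poly_time_compose[OF assms(1)] poly_time_compose[OF assms(3)])

lemma poly_time_slot_counts [poly_time_intros]:
  assumes "poly_time ws" "poly_time bits"
  shows "poly_time (\<lambda>x. slot_counts b (ws x) (bits x))"
  unfolding slot_counts_def
  by (intro poly_time_intros poly_time_indices assms
      poly_time_compose[OF assms(1)] poly_time_compose[OF assms(2)])

text \<open>This supplies the accumulator bound for the rounding loop: no entries other than 0 and
  \<open>Z\<close> are ever created.\<close>

lemma foldl_round_step_entries:
  "length (foldl (round_step A Z h ns es) z is) = length z \<and>
   set (foldl (round_step A Z h ns es) z is) \<subseteq> insert 0 (insert Z (set z))"
proof (induction "is" arbitrary: z)
  case (Cons i "is")
  have "length (round_step A Z h ns es z i) = length z"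
    "set (round_step A Z h ns es z i) \<subseteq> insert 0 (insert Z (set z))"
    using set_update_subset_insert[of z i] by (auto simp: round_step_def)
  then show ?case
    using Cons[of "round_step A Z h ns es z i"] by auto
qed auto

lemma poly_time_rounding [poly_time_intros]:
  assumes A: "poly_time A" and Z: "poly_time Z" and ns: "poly_time ns" and es: "poly_time es"
    and z: "poly_time z" and "is": "poly_time is"
  shows "poly_time (\<lambda>x. foldl (round_step (A x) (Z x) h (ns x) (es x)) (z x) (is x))"
proof -
  obtain p where p: "\<And>x. esize (z x) \<le> poly p (esize x)"
    using poly_time_output_size[OF z] by blast
  obtain q where q: "\<And>x. esize (Z x) \<le> poly q (esize x)"
    using poly_time_output_size[OF Z] by blast
  show ?thesis
  proof (rule poly_time_foldl[where q = "[:1:] + p * ([:1:] + (p + q + [:1:]))"])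
    show "poly_time (\<lambda>p. round_step (A (fst p)) (Z (fst p)) h (ns (fst p)) (es (fst p))
        (fst (snd p)) (snd (snd p)))"
      unfolding round_step_def
      by (intro poly_time_intros poly_time_compose[OF A] poly_time_compose[OF Z]
          poly_time_compose[OF ns] poly_time_compose[OF es])
  next
    fix x j
    let ?f = "foldl (round_step (A x) (Z x) h (ns x) (es x)) (z x) (take j (is x))"
    have f: "length ?f = length (z x)" "set ?f \<subseteq> insert 0 (insert (Z x) (set (z x)))"
      using foldl_round_step_entries by blast+
    have "esize y \<le> poly p (esize x) + poly q (esize x) + 1" if "y \<in> set ?f" for y
    proof -
      have "esize y \<le> esize (z x) + esize (Z x) + 1"
        using subsetD[OF f(2) that] esize_le_esize_list[of y "z x"] by (auto simp: encode_nat_def)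
      then show ?thesis using p[of x] q[of x] by simp
    qed
    then have "esize ?f \<le> 1 + length ?f * (1 + (poly p (esize x) + poly q (esize x) + 1))"
      by (rule esize_list_le)
    also have "\<dots> \<le> 1 + poly p (esize x) * (1 + (poly p (esize x) + poly q (esize x) + 1))"
      using f(1) length_le_esize[of "z x"] p[of x] by (intro add_mono mult_right_mono) auto
    finally show "esize ?f \<le> poly ([:1:] + p * ([:1:] + (p + q + [:1:]))) (esize x)"
      by (simp add: algebra_simps)
  qed (intro z "is")+
qed

lemma poly_time_decode:
  assumes "poly_time ws" "poly_time es" "poly_time bits"
  shows "poly_time (\<lambda>x. decode a b h (ws x) (es x) (bits x))"
  unfolding decode_def rounded_def Let_def
  by (intro poly_time_intros poly_time_indices assms)

section \<open>Derandomised rounding\<close>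

definition valid_edge :: "nat \<Rightarrow> nat list \<Rightarrow> bool" where
  "valid_edge n e \<longleftrightarrow> distinct e \<and> set e \<subseteq> {..<n}"

lemma edge_prod_eq:
  assumes "valid_edge (length z) e"
  shows "edge_prod z e = (\<Prod>i\<in>set e. z ! i)"
proof -
  have "edge_prod z e = prod_list (map (nth z) e)"
    using assms unfolding edge_prod_def valid_edge_def
    by (intro arg_cong[of _ _ prod_list] map_cong) (auto intro!: lookup_eq_nth)
  then show ?thesis
    using assms by (simp add: valid_edge_def prod.distinct_set_conv_list)
qed

lemma outer_weight_eq:
  assumes "length z = length ns"
  shows "outer_weight ns z e = (\<Sum>j\<in>{..<length ns} - set e. ns ! j * z ! j)"
proof -
  have "outer_weight ns z e = (\<Sum>j<length ns. if j \<in> set e then 0 else ns ! j * z ! j)"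
    using assms by (auto simp: outer_weight_def sum_list_enumerate lookup_eq_nth intro!: sum.cong)
  also have "\<dots> = (\<Sum>j\<in>{..<length ns} - set e. ns ! j * z ! j)"
    by (intro sum.mono_neutral_cong_right) auto
  finally show ?thesis .
qed

section \<open>The multi-affine potential and its greedy rounding\<close>

definition potential :: "nat \<Rightarrow> nat \<Rightarrow> nat list \<Rightarrow> nat list list \<Rightarrow> nat list \<Rightarrow> int" where
  "potential A h ns es z = int (gain A es z) - int (loss h ns es z)"

definition edge_term :: "nat \<Rightarrow> nat \<Rightarrow> nat list \<Rightarrow> nat list \<Rightarrow> nat list \<Rightarrow> int" where
  "edge_term A h ns z e = int (edge_prod z e) * (int A - int h * int (outer_weight ns z e))"

lemma potential_eq: "potential A h ns es z = (\<Sum>e\<leftarrow>es. edge_term A h ns z e)"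
  by (induction es) (auto simp: potential_def gain_def loss_def edge_term_def algebra_simps)

text \<open>A vertex of \<open>e\<close> occurs once in the product and not in the outer weight; any
  other vertex occurs linearly in the outer weight and not in the product.\<close>

lemma edge_term_affine:
  assumes "valid_edge (length z) e" "length z = length ns" "i < length z"
  shows "\<exists>\<alpha> \<beta>. \<forall>v. edge_term A h ns (z[i := v]) e = \<alpha> + \<beta> * int v"
proof (cases "i \<in> set e")
  case True
  have "edge_prod (z[i := v]) e = v * (\<Prod>j\<in>set e - {i}. z ! j)" for v
  proof -
    have "edge_prod (z[i := v]) e = (\<Prod>j\<in>set e. z[i := v] ! j)"
      using assms by (intro edge_prod_eq) simp
    also have "\<dots> = z[i := v] ! i * (\<Prod>j\<in>set e - {i}. z[i := v] ! j)"
      using True by (intro prod.remove) auto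
    also have "(\<Prod>j\<in>set e - {i}. z[i := v] ! j) = (\<Prod>j\<in>set e - {i}. z ! j)"
      by (intro prod.cong) auto
    finally show ?thesis using assms by simp
  qed
  moreover have "outer_weight ns (z[i := v]) e = outer_weight ns z e" for v
  proof -
    have "(\<Sum>j\<in>{..<length ns} - set e. ns ! j * z[i := v] ! j) =
        (\<Sum>j\<in>{..<length ns} - set e. ns ! j * z ! j)"
      using True by (intro sum.cong refl) (metis DiffD2 nth_list_update_neq)
    then show ?thesis using assms by (simp add: outer_weight_eq)
  qed
  ultimately have "\<forall>v. edge_term A h ns (z[i := v]) e = 0 + (int (\<Prod>j\<in>set e - {i}. z ! j) *
      (int A - int h * int (outer_weight ns z e))) * int v"
    by (simp add: edge_term_def)
  then show ?thesis by blast
next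
  case False
  have "edge_prod (z[i := v]) e = edge_prod z e" for v
  proof -
    have "(\<Prod>j\<in>set e. z[i := v] ! j) = (\<Prod>j\<in>set e. z ! j)"
      using False by (intro prod.cong refl) (metis nth_list_update_neq)
    then show ?thesis using assms by (simp add: edge_prod_eq)
  qed
  moreover have "outer_weight ns (z[i := v]) e =
      ns ! i * v + (\<Sum>j\<in>{..<length ns} - set e - {i}. ns ! j * z ! j)" for v
  proof -
    have "outer_weight ns (z[i := v]) e = (\<Sum>j\<in>{..<length ns} - set e. ns ! j * z[i := v] ! j)"
      using assms by (simp add: outer_weight_eq)
    also have "\<dots> = ns ! i * z[i := v] ! i +
        (\<Sum>j\<in>{..<length ns} - set e - {i}. ns ! j * z[i := v] ! j)"
      using False assms by (intro sum.remove) auto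
    also have "(\<Sum>j\<in>{..<length ns} - set e - {i}. ns ! j * z[i := v] ! j) =
        (\<Sum>j\<in>{..<length ns} - set e - {i}. ns ! j * z ! j)"
      by (intro sum.cong) auto
    finally show ?thesis using assms by simp
  qed
  ultimately have "\<forall>v. edge_term A h ns (z[i := v]) e =
      int (edge_prod z e) * (int A - int h * int (\<Sum>j\<in>{..<length ns} - set e - {i}. ns ! j * z ! j))
      + (- int (edge_prod z e) * int h * int (ns ! i)) * int v"
    by (simp add: edge_term_def algebra_simps)
  then show ?thesis by blast
qed

lemma potential_affine:
  assumes "\<And>e. e \<in> set es \<Longrightarrow> valid_edge (length z) e" "length z = length ns" "i < length z"
  shows "\<exists>\<alpha> \<beta>. \<forall>v. potential A h ns es (z[i := v]) = \<alpha> + \<beta> * int v"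
  using assms(1)
proof (induction es)
  case Nil
  show ?case by (intro exI[of _ 0]) (simp add: potential_eq)
next
  case (Cons e es)
  then obtain \<alpha> \<beta> where 1: "\<forall>v. potential A h ns es (z[i := v]) = \<alpha> + \<beta> * int v" by auto
  obtain \<alpha>' \<beta>' where 2: "\<forall>v. edge_term A h ns (z[i := v]) e = \<alpha>' + \<beta>' * int v"
    using edge_term_affine[OF _ assms(2,3), of e A h] Cons.prems by auto
  have "\<forall>v. potential A h ns (e # es) (z[i := v]) = (\<alpha> + \<alpha>') + (\<beta> + \<beta>') * int v"
    using 1 2 by (simp add: potential_eq algebra_simps)
  then show ?case by blast
qed

text \<open>An affine function on an interval is maximal at an endpoint. Ties go to 0, so
  \<open>Z\<close> is chosen only for a positive slope, and then \<open>z ! i < Z\<close> makes the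
  increase strict.\<close>

lemma round_step_potential:
  fixes A h :: nat
  assumes "\<And>e. e \<in> set es \<Longrightarrow> valid_edge (length z) e" "length z = length ns" "i < length z"
    and "z ! i < Z"
  defines "z' \<equiv> round_step A Z h ns es z i"
  shows "(z' = z[i := 0] \<and> potential A h ns es z \<le> potential A h ns es z') \<or>
    (z' = z[i := Z] \<and> potential A h ns es z < potential A h ns es z')"
proof -
  obtain \<alpha> \<beta> where ab: "\<And>v. potential A h ns es (z[i := v]) = \<alpha> + \<beta> * int v"
    using potential_affine[where es = es and A = A and h = h, OF assms(1-3)] by auto
  have z: "potential A h ns es z = \<alpha> + \<beta> * int (z ! i)"
    using ab[of "z ! i"] by simp
  have step: "z' = (if potential A h ns es (z[i := 0]) < potential A h ns es (z[i := Z])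
      then z[i := Z] else z[i := 0])"
    unfolding z'_def round_step_def potential_def by (rule if_cong) auto
  show ?thesis
  proof (cases "\<beta> * int Z > 0")
    case True
    then have "\<beta> > 0" using assms(4) by (simp add: zero_less_mult_iff)
    then have "\<beta> * int (z ! i) < \<beta> * int Z" using assms(4) by simp
    then show ?thesis using step True ab z by simp
  next
    case False
    then have "\<beta> \<le> 0" using assms(4) by (simp add: zero_less_mult_iff)
    then have "\<beta> * int (z ! i) \<le> 0" by (simp add: mult_nonpos_nonneg)
    then show ?thesis using step False ab z by simp
  qed
qed

text \<open>The strict alternative matters because the initial potential may be 0: as soon as one
  vertex receives \<open>Z\<close>, the final potential is strictly larger than the initial
  one.\<close>

lemma rounding_potential:
  fixes A h :: nat
  assumes "\<And>e. e \<in> set es \<Longrightarrow> valid_edge (length z) e" "length z = length ns"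
    and Z: "\<And>i. i < length z \<Longrightarrow> z ! i < Z" and "m \<le> length z"
  defines "f \<equiv> \<lambda>m. foldl (round_step A Z h ns es) z [0..<m]"
  shows "length (f m) = length z \<and> (\<forall>i<m. f m ! i \<in> {0, Z}) \<and>
    (\<forall>i. m \<le> i \<longrightarrow> i < length z \<longrightarrow> f m ! i = z ! i) \<and>
    potential A h ns es z \<le> potential A h ns es (f m) \<and>
    (potential A h ns es z < potential A h ns es (f m) \<or> (\<forall>i<m. f m ! i = 0))"
  using \<open>m \<le> length z\<close>
proof (induction m)
  case 0
  then show ?case by (simp add: f_def)
next
  case (Suc m)
  then have IH: "length (f m) = length z" "\<forall>i<m. f m ! i \<in> {0, Z}"
    "\<forall>i. m \<le> i \<longrightarrow> i < length z \<longrightarrow> f m ! i = z ! i"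
    "potential A h ns es z \<le> potential A h ns es (f m)"
    "potential A h ns es z < potential A h ns es (f m) \<or> (\<forall>i<m. f m ! i = 0)" by auto
  have f: "f (Suc m) = round_step A Z h ns es (f m) m" by (simp add: f_def)
  have "(f (Suc m) = (f m)[m := 0] \<and> potential A h ns es (f m) \<le> potential A h ns es (f (Suc m))) \<or>
    (f (Suc m) = (f m)[m := Z] \<and> potential A h ns es (f m) < potential A h ns es (f (Suc m)))"
    unfolding f by (rule round_step_potential) (use assms(1,2) Z IH Suc.prems in auto)
  then show ?case
  proof (elim disjE conjE)
    assume *: "f (Suc m) = (f m)[m := 0]"
      "potential A h ns es (f m) \<le> potential A h ns es (f (Suc m))"
    have "f (Suc m) ! i = (if i = m then 0 else f m ! i)" if "i < length z" for i
      using that IH(1) *(1) by auto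
    then show ?thesis using IH * Suc.prems by (auto simp: less_Suc_eq)
  next
    assume *: "f (Suc m) = (f m)[m := Z]"
      "potential A h ns es (f m) < potential A h ns es (f (Suc m))"
    have "f (Suc m) ! i = (if i = m then Z else f m ! i)" if "i < length z" for i
      using that IH(1) *(1) by auto
    then show ?thesis using IH * Suc.prems by (auto simp: less_Suc_eq)
  qed
qed

lemma edge_prod_zero_or_Z:
  assumes "valid_edge (length z) e" "\<forall>i<length z. z ! i \<in> {0, Z}"
  shows "edge_prod z e = (if \<forall>i\<in>set e. z ! i \<noteq> 0 then Z ^ length e else 0)"
proof (cases "\<forall>i\<in>set e. z ! i \<noteq> 0")
  case True
  then have "(\<Prod>i\<in>set e. z ! i) = (\<Prod>i\<in>set e. Z)"
    using assms by (intro prod.cong) (fastforce simp: valid_edge_def)+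
  then show ?thesis
    using True assms by (simp add: edge_prod_eq valid_edge_def distinct_card)
qed (use assms in \<open>auto simp: edge_prod_eq\<close>)

lemma gain_zero_or_Z:
  assumes "\<And>e. e \<in> set es \<Longrightarrow> valid_edge (length z) e \<and> length e = r" "\<forall>i<length z. z ! i \<in> {0, Z}"
  shows "gain A es z = A * Z ^ r * length (filter (\<lambda>e. \<forall>i\<in>set e. z ! i \<noteq> 0) es)"
  using assms(1) unfolding gain_def
  by (induction es) (auto simp: edge_prod_zero_or_Z[OF _ assms(2)] algebra_simps)

text \<open>A positive sum has a positive term. Its first factor says that \<open>e\<close> is
  labeled 1, its second bounds the weight outside \<open>e\<close>.\<close>

lemma potential_pos_imp_edge:
  assumes "\<And>e. e \<in> set es \<Longrightarrow> valid_edge (length z) e" "potential A h ns es z > 0"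
  obtains e where "e \<in> set es" "\<forall>i\<in>set e. z ! i \<noteq> 0" "h * outer_weight ns z e < A"
proof -
  have "\<exists>e\<in>set es. edge_term A h ns z e > 0"
  proof (rule ccontr)
    assume "\<not> ?thesis"
    then have "(\<Sum>e\<leftarrow>es. edge_term A h ns z e) \<le> 0"
      by (intro sum_list_nonpos) force
    then show False using assms(2) by (simp add: potential_eq)
  qed
  then obtain e where e: "e \<in> set es" "edge_term A h ns z e > 0" by blast
  then have "edge_prod z e > 0" "int A - int h * int (outer_weight ns z e) > 0"
    by (auto simp: edge_term_def zero_less_mult_iff)
  then have "edge_prod z e > 0" "h * outer_weight ns z e < A"
    by (simp_all flip: of_nat_mult)
  then show ?thesis
    using that[OF e(1)] edge_prod_eq[OF assms(1)[OF e(1)]] by auto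
qed

section \<open>Clouds\<close>

definition cloud :: "nat list \<Rightarrow> nat \<Rightarrow> nat set" where
  "cloud ns i = {offset ns i..<offset ns i + ns ! i}"

lemma offset_eq:
  assumes "i \<le> length ns"
  shows "offset ns i = (\<Sum>j<i. ns ! j)"
proof -
  have "offset ns i = (\<Sum>j<length ns. if j < i then ns ! j else 0)"
    by (simp add: offset_def sum_list_enumerate cong: if_cong)
  also have "\<dots> = (\<Sum>j<i. ns ! j)"
    using assms by (intro sum.mono_neutral_cong_right) auto
  finally show ?thesis .
qed

lemma offset_add_le:
  assumes "i < j" "j \<le> length ns"
  shows "offset ns i + ns ! i \<le> offset ns j"
proof -
  have "offset ns i + ns ! i = (\<Sum>l<Suc i. ns ! l)"
    using assms by (simp add: offset_eq)
  also have "\<dots> \<le> (\<Sum>l<j. ns ! l)"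
    using assms by (intro sum_mono2) auto
  finally show ?thesis using assms by (simp add: offset_eq)
qed

lemma cloud_disjoint:
  assumes "i < length ns" "j < length ns" "i \<noteq> j"
  shows "cloud ns i \<inter> cloud ns j = {}"
proof (cases "i < j")
  case True
  then show ?thesis using offset_add_le[of i j ns] assms by (auto simp: cloud_def)
next
  case False
  then show ?thesis using offset_add_le[of j i ns] assms by (auto simp: cloud_def)
qed

lemma cloud_subset:
  assumes "i < length ns"
  shows "cloud ns i \<subseteq> {..<sum_list ns}"
proof -
  have "offset ns i + ns ! i \<le> offset ns (length ns)"
    using assms by (intro offset_add_le) auto
  also have "\<dots> = sum_list ns"
    by (simp add: offset_eq sum_list_sum_nth atLeast0LessThan)
  finally show ?thesis by (auto simp: cloud_def)
qed

lemma cloud_copy_in_cloud: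
  assumes "i < length ns" "ns ! i > 0"
  shows "cloud_copy ns i t \<in> cloud ns i"
  using assms by (simp add: cloud_copy_def cloud_def lookup_eq_nth)

text \<open>Within a residue class, \<open>t\<close> is determined by its quotient, which is at most
  \<open>q div m\<close>.\<close>

lemma card_residue_class_le: "card {t. t < q \<and> t mod m = c} \<le> q div m + 1" for m :: nat
proof -
  have "inj_on (\<lambda>t. t div m) {t. t < q \<and> t mod m = c}"
    by (rule inj_onI) (metis (mono_tags, lifting) div_mult_mod_eq mem_Collect_eq)
  moreover have "(\<lambda>t. t div m) ` {t. t < q \<and> t mod m = c} \<subseteq> {..q div m}"
    by (auto intro: div_le_mono)
  ultimately show ?thesis
    using card_inj_on_le[of _ _ "{..q div m}"] by fastforce
qed

text \<open>Reading a cloud of size m cyclically hits each copy at most \<open>q div m + 1\<close>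
  times, and m times this is at most q + m \<le> 2q. The factor 2 is the price for m not dividing
  q.\<close>

lemma slots_in_set_le:
  assumes "i < length ns" "ns ! i > 0" "ns ! i \<le> q" "finite S"
  shows "ns ! i * card {t. t < q \<and> cloud_copy ns i t \<in> S} \<le> 2 * q * card (S \<inter> cloud ns i)"
proof -
  let ?m = "ns ! i"
  have "{t. t < q \<and> cloud_copy ns i t \<in> S} \<subseteq>
      (\<Union>v \<in> S \<inter> cloud ns i. {t. t < q \<and> t mod ?m = v - offset ns i})"
    using cloud_copy_in_cloud[OF assms(1,2)] assms(1)
    by (auto simp: cloud_copy_def lookup_eq_nth intro!: bexI)
  then have "card {t. t < q \<and> cloud_copy ns i t \<in> S} \<le>
      card (\<Union>v \<in> S \<inter> cloud ns i. {t. t < q \<and> t mod ?m = v - offset ns i})"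
    using assms(4) by (intro card_mono) auto
  also have "\<dots> \<le> (\<Sum>v \<in> S \<inter> cloud ns i. card {t. t < q \<and> t mod ?m = v - offset ns i})"
    using assms(4) by (intro card_UN_le) auto
  also have "\<dots> \<le> (\<Sum>v \<in> S \<inter> cloud ns i. q div ?m + 1)"
    by (intro sum_mono card_residue_class_le)
  also have "\<dots> = card (S \<inter> cloud ns i) * (q div ?m + 1)" by simp
  finally have "?m * card {t. t < q \<and> cloud_copy ns i t \<in> S} \<le>
      ?m * (card (S \<inter> cloud ns i) * (q div ?m + 1))"
    by (rule mult_le_mono2)
  also have "\<dots> = card (S \<inter> cloud ns i) * (?m * (q div ?m + 1))"
    by (rule mult.left_commute)
  also have "\<dots> \<le> card (S \<inter> cloud ns i) * (2 * q)"
    using add_mono[OF times_div_less_eq_dividend[of ?m q] assms(3)]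
    by (intro mult_le_mono2) simp
  also have "\<dots> = 2 * q * card (S \<inter> cloud ns i)"
    by (rule mult.commute)
  finally show ?thesis .
qed

lemma sum_card_cloud_le:
  assumes "finite S"
  shows "(\<Sum>i<length ns. card (S \<inter> cloud ns i)) \<le> card S"
proof -
  have "(\<Sum>i<length ns. card (S \<inter> cloud ns i)) = card (\<Union>i<length ns. S \<inter> cloud ns i)"
    using cloud_disjoint[of _ ns] assms by (intro card_UN_disjoint[symmetric]) blast+
  also have "\<dots> \<le> card S"
    using assms by (intro card_mono) auto
  finally show ?thesis .
qed

lemma length_filter_concat_map:
  "length (filter P (concat (map f xs))) = (\<Sum>x\<leftarrow>xs. length (filter P (f x)))"
  by (induction xs) auto

lemma sum_list_if_const:
  "(\<Sum>x\<leftarrow>xs. if P x then c else 0) = c * length (filter P xs)" for c :: nat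
  by (induction xs) auto

text \<open>The copies of the vertices of \<open>e\<close> are chosen independently, so the number
  of choices that land in \<open>S\<close> factors over the vertices.\<close>

lemma length_filter_n_lists:
  "length (filter (\<lambda>ts. \<forall>v\<in>set (map2 \<phi> e ts). v \<in> S) (List.n_lists (length e) ts)) =
   prod_list (map (\<lambda>i. length (filter (\<lambda>t. \<phi> i t \<in> S) ts)) e)"
proof (induction e)
  case (Cons i e)
  let ?P = "\<lambda>us. \<forall>v\<in>set (map2 \<phi> e us). v \<in> S"
  have "length (filter (\<lambda>us. \<forall>v\<in>set (map2 \<phi> (i # e) us). v \<in> S) (map (\<lambda>y. y # us) ts)) =
      (if ?P us then length (filter (\<lambda>t. \<phi> i t \<in> S) ts) else 0)" for us
    by (induction ts) auto
  then have "length (filter (\<lambda>us. \<forall>v\<in>set (map2 \<phi> (i # e) us). v \<in> S) (List.n_lists (length (i # e)) ts)) =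
      (\<Sum>us\<leftarrow>List.n_lists (length e) ts. if ?P us then length (filter (\<lambda>t. \<phi> i t \<in> S) ts) else 0)"
    by (simp only: length_Cons n_lists.simps length_filter_concat_map)
  also have "\<dots> = length (filter (\<lambda>t. \<phi> i t \<in> S) ts) * length (filter ?P (List.n_lists (length e) ts))"
    by (rule sum_list_if_const)
  finally show ?case using Cons by simp
qed simp

section \<open>Correctness of the reduction\<close>

locale weighted_instance =
  fixes ws :: "(nat \<times> nat) list" and es :: "nat list list" and a b h r :: nat
  assumes W_pos: "sum_list (int_weights ws) > 0"
    and a_pos: "a > 0" and b_pos: "b > 0" and h_pos: "h > 0"
    and edges: "\<And>e. e \<in> set es \<Longrightarrow> valid_edge (length ws) e \<and> length e = r"
begin

definition "n = length ws"
definition "wt i = int_weights ws ! i"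
definition "W = sum_list (int_weights ws)"
definition "ns = cloud_sizes b ws"
definition "Q = 2 * b * n"
definition "les = light_edges a b ws es"
definition "slot_prod S e = prod_list (map (\<lambda>i. card {t. t < Q \<and> cloud_copy ns i t \<in> S}) e)"

lemma length_int_weights [simp]: "length (int_weights ws) = n"
  by (simp add: int_weights_def n_def)

lemma length_ns [simp]: "length ns = n"
  by (simp add: ns_def cloud_sizes_def)

lemma W_gt_0: "W > 0"
  using W_pos by (simp add: W_def)

lemma n_pos: "n > 0"
proof (rule ccontr)
  assume "\<not> ?thesis"
  then have "ws = []" by (simp add: n_def)
  then show False using W_pos by (simp add: int_weights_def)
qed

lemma Q_pos: "Q > 0"
  using n_pos b_pos by (simp add: Q_def)

lemma W_eq: "W = (\<Sum>i<n. wt i)"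
  by (simp add: W_def wt_def sum_list_sum_nth atLeast0LessThan)

lemma ns_nth: "i < n \<Longrightarrow> ns ! i = wt i * (b * n) div W + 1"
  by (simp add: ns_def cloud_sizes_def W_def wt_def n_def[symmetric])

lemma ns_pos: "i < n \<Longrightarrow> ns ! i > 0"
  by (simp add: ns_nth)

lemma wt_le_ns: "i < n \<Longrightarrow> wt i * (b * n) \<le> ns ! i * W"
proof -
  assume "i < n"
  have "wt i * (b * n) < W * (wt i * (b * n) div W + 1)"
    using dividend_less_times_div[OF W_gt_0, of "wt i * (b * n)"] by simp
  then show ?thesis using \<open>i < n\<close> by (simp add: ns_nth mult.commute)
qed

text \<open>The floors contribute at most \<open>c * n\<close>, and the added ones at most
  \<open>card T \<le> n \<le> c * n\<close>. The case \<open>c = b\<close> bounds all clouds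
  together, \<open>c = a\<close> the clouds of a labeled set.\<close>

lemma sum_ns_le:
  assumes "T \<subseteq> {..<n}" "b * sum wt T \<le> c * W" "c > 0"
  shows "(\<Sum>i\<in>T. ns ! i) \<le> 2 * c * n"
proof -
  have fin: "finite T" using assms(1) finite_subset by blast
  have "W * (\<Sum>i\<in>T. wt i * (b * n) div W) \<le> (\<Sum>i\<in>T. wt i * (b * n))"
    unfolding sum_distrib_left by (intro sum_mono) simp
  also have "\<dots> = b * sum wt T * n"
    by (simp add: sum_distrib_left sum_distrib_right mult_ac)
  also have "\<dots> \<le> W * (c * n)"
    using mult_right_mono[OF assms(2), of n] by (simp add: mult_ac)
  finally have 1: "(\<Sum>i\<in>T. wt i * (b * n) div W) \<le> c * n"
    using W_gt_0 by simp
  have "card T \<le> n"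
    using card_mono[OF _ assms(1)] by simp
  also have "n \<le> c * n" using assms(3) by simp
  finally have 2: "card T \<le> c * n" .
  have "(\<Sum>i\<in>T. ns ! i) = (\<Sum>i\<in>T. wt i * (b * n) div W + 1)"
    using assms(1) by (intro sum.cong) (auto simp: ns_nth)
  also have "\<dots> = (\<Sum>i\<in>T. wt i * (b * n) div W) + card T"
    by (simp only: sum.distrib) simp
  finally show ?thesis using 1 2 by simp
qed

lemma sum_list_ns_le: "sum_list ns \<le> Q"
  using sum_ns_le[of "{..<n}" b] b_pos
  by (simp add: W_eq Q_def sum_list_sum_nth atLeast0LessThan)

lemma ns_le_Q: "i < n \<Longrightarrow> ns ! i \<le> Q"
  using member_le_sum_list[of "ns ! i" ns] sum_list_ns_le by simp

lemma cloud_subset_Q: "i < n \<Longrightarrow> cloud ns i \<subseteq> {..<Q}"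
  using cloud_subset[of i ns] sum_list_ns_le by auto

lemma sum_lookup_int_weights:
  assumes "valid_edge n e"
  shows "(\<Sum>i\<leftarrow>e. lookup (int_weights ws) i) = (\<Sum>i\<in>set e. wt i)"
proof -
  have "(\<Sum>i\<leftarrow>e. lookup (int_weights ws) i) = (\<Sum>i\<leftarrow>e. wt i)"
    using assms by (intro arg_cong[of _ _ sum_list] map_cong)
      (auto simp: valid_edge_def lookup_eq_nth wt_def)
  also have "\<dots> = (\<Sum>i\<in>set e. wt i)"
    using assms by (simp add: valid_edge_def sum.distinct_set_conv_list)
  finally show ?thesis .
qed

lemma les_edges: "e \<in> set les \<Longrightarrow> valid_edge n e \<and> length e = r \<and> b * (\<Sum>i\<in>set e. wt i) \<le> a * W"
proof -
  assume e: "e \<in> set les"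
  then have "e \<in> set es" by (simp add: les_def light_edges_def)
  then have v: "valid_edge n e" "length e = r" using edges by (auto simp: n_def)
  show ?thesis
    using e v sum_lookup_int_weights[OF v(1)] by (simp add: les_def light_edges_def W_def)
qed

lemma cloud_edges_eq:
  "cloud_edges r a b ws es =
     concat (map (\<lambda>e. map (map2 (cloud_copy ns) e) (List.n_lists r [0..<Q])) les)"
proof -
  have "map (\<lambda>j. cloud_copy ns (lookup e j) (lookup ts j)) [0..<r] = map2 (cloud_copy ns) e ts"
    if "e \<in> set les" "ts \<in> set (List.n_lists r [0..<Q])" for e ts
  proof -
    have "length e = r" "length ts = r"
      using les_edges[OF that(1)] that(2) by (auto simp: set_n_lists)
    then show ?thesis by (intro nth_equalityI) (auto simp: lookup_eq_nth)
  qed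
  then show ?thesis
    unfolding cloud_edges_def ns_def[symmetric] les_def[symmetric]
    by (intro arg_cong[of _ _ concat] map_cong refl) (auto simp: slots_def Q_def n_def)
qed

text \<open>Distinct vertices of \<open>e\<close> have disjoint clouds, so their copies are distinct
  and a lifted hyperedge keeps its arity.\<close>

lemma cloud_edges_valid:
  assumes "e' \<in> set (cloud_edges r a b ws es)"
  shows "valid_edge Q e' \<and> length e' = r"
proof -
  obtain e ts where e: "e \<in> set les" and ts: "ts \<in> set (List.n_lists r [0..<Q])"
    and e': "e' = map2 (cloud_copy ns) e ts"
    using assms unfolding cloud_edges_eq by auto
  have v: "valid_edge n e" "length e = r" using les_edges[OF e] by auto
  have len: "length ts = r" using ts by (simp add: set_n_lists)
  have mem: "e' ! j \<in> cloud ns (e ! j)" "e ! j < n" if "j < r" for j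
  proof -
    show "e ! j < n" using v that nth_mem[of j e] unfolding valid_edge_def by blast
    then show "e' ! j \<in> cloud ns (e ! j)"
      using that v len ns_pos cloud_copy_in_cloud[of "e ! j" ns] by (simp add: e')
  qed
  have le: "length e' = r" using v len by (simp add: e')
  have "e' ! i \<noteq> e' ! j" if "i < r" "j < r" "i \<noteq> j" for i j
  proof -
    have "e ! i \<noteq> e ! j"
      using that v by (simp add: valid_edge_def nth_eq_iff_index_eq)
    then show ?thesis
      using mem[OF that(1)] mem[OF that(2)] cloud_disjoint[of "e ! i" ns "e ! j"] by auto
  qed
  then have "distinct e'" using le by (simp add: distinct_conv_nth)
  moreover have "set e' \<subseteq> {..<Q}"
    using mem cloud_subset_Q le by (auto simp: in_set_conv_nth) blast
  ultimately show ?thesis using le by (simp add: valid_edge_def)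
qed

lemma length_cloud_edges: "length (cloud_edges r a b ws es) = length les * Q ^ r"
proof -
  have "length (cloud_edges r a b ws es) =
      (\<Sum>e\<leftarrow>les. length (List.n_lists r [0..<Q]))"
    unfolding cloud_edges_eq length_concat by (simp add: comp_def)
  then show ?thesis by (simp add: length_n_lists sum_list_triv)
qed

lemma count_cloud_edges:
  "length (filter (\<lambda>e. \<forall>v\<in>set e. v \<in> S) (cloud_edges r a b ws es)) = (\<Sum>e\<leftarrow>les. slot_prod S e)"
proof -
  have "length (filter (\<lambda>e. \<forall>v\<in>set e. v \<in> S) (map (map2 (cloud_copy ns) e) (List.n_lists r [0..<Q])))
      = slot_prod S e" if "e \<in> set les" for e
  proof -
    have "length (filter (\<lambda>t. cloud_copy ns i t \<in> S) [0..<Q]) = card {t. t < Q \<and> cloud_copy ns i t \<in> S}" for i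
      by (simp add: length_filter_conv_card) (rule arg_cong[of _ _ card], auto)
    moreover have "length e = r" using les_edges[OF that] by simp
    ultimately show ?thesis
      using length_filter_n_lists[of "cloud_copy ns" e S "[0..<Q]"]
      by (simp only: slot_prod_def filter_map length_map comp_def)
  qed
  then show ?thesis
    unfolding cloud_edges_eq length_filter_concat_map
    by (intro arg_cong[of _ _ sum_list] map_cong refl)
qed

text \<open>Take the union of the clouds of labeled vertices. All \<open>Q\<close> slots of such a
  vertex lie in it, so a labeled hyperedge keeps all its \<open>Q ^ r\<close> copies.\<close>

lemma lift_labeling:
  assumes "b * sum wt {i. i < n \<and> \<sigma> i} \<le> a * W" "a \<le> b"
  obtains T where "T \<subseteq> {..<Q}" "card T = 2 * a * n"
    "length (filter (\<lambda>e. \<forall>i\<in>set e. \<sigma> i) les) * Q ^ r \<le>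
      length (filter (\<lambda>e. \<forall>v\<in>set e. v \<in> T) (cloud_edges r a b ws es))"
proof -
  let ?U = "\<Union>i\<in>{i. i < n \<and> \<sigma> i}. cloud ns i"
  have "card ?U \<le> (\<Sum>i\<in>{i. i < n \<and> \<sigma> i}. card (cloud ns i))"
    by (intro card_UN_le) simp
  also have "\<dots> = (\<Sum>i\<in>{i. i < n \<and> \<sigma> i}. ns ! i)"
    by (simp add: cloud_def)
  also have "\<dots> \<le> 2 * a * n"
    using assms(1) a_pos by (intro sum_ns_le) auto
  finally have "card ?U \<le> 2 * a * n" .
  moreover have "?U \<subseteq> {..<Q}" using cloud_subset_Q by blast
  moreover have "2 * a * n \<le> card {..<Q}" using assms(2) by (simp add: Q_def)
  \<comment> \<open>The set must have exactly k elements. Padding only adds hyperedges, and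
    \<open>a \<le> b\<close> leaves room for it.\<close>
  ultimately obtain T where T: "?U \<subseteq> T" "T \<subseteq> {..<Q}" "card T = 2 * a * n"
    using exists_subset_between[of ?U "2 * a * n" "{..<Q}"] by auto
  have "slot_prod T e \<ge> (if \<forall>i\<in>set e. \<sigma> i then Q ^ r else 0)" if e: "e \<in> set les" for e
  proof (cases "\<forall>i\<in>set e. \<sigma> i")
    case True
    have "card {t. t < Q \<and> cloud_copy ns i t \<in> T} = Q" if "i \<in> set e" for i
    proof -
      have "i < n" using les_edges[OF e] that by (auto simp: valid_edge_def)
      then have "cloud_copy ns i t \<in> T" for t
        using T(1) True that cloud_copy_in_cloud[of i ns t] ns_pos[of i] by auto
      then show ?thesis by simp
    qed
    then have "slot_prod T e = prod_list (map (\<lambda>i. Q) e)"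
      unfolding slot_prod_def by (intro arg_cong[of _ _ prod_list] map_cong refl)
    also have "\<dots> = Q ^ r"
      using les_edges[OF e] by (simp add: map_replicate_const)
    finally show ?thesis by simp
  qed auto
  then have "(\<Sum>e\<leftarrow>les. if \<forall>i\<in>set e. \<sigma> i then Q ^ r else 0) \<le> (\<Sum>e\<leftarrow>les. slot_prod T e)"
    by (intro sum_list_mono)
  then have "length (filter (\<lambda>e. \<forall>i\<in>set e. \<sigma> i) les) * Q ^ r \<le>
      length (filter (\<lambda>e. \<forall>v\<in>set e. v \<in> T) (cloud_edges r a b ws es))"
    by (simp only: sum_list_if_const count_cloud_edges mult.commute)
  with T show ?thesis using that by blast
qed

text \<open>A hyperedge inside the labeled set weighs at most as much as that set, so discarding
  heavy hyperedges loses nothing here.\<close>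

lemma light_if_labeled:
  assumes "b * sum wt {i. i < n \<and> \<sigma> i} \<le> a * W"
  shows "filter (\<lambda>e. \<forall>i\<in>set e. \<sigma> i) les = filter (\<lambda>e. \<forall>i\<in>set e. \<sigma> i) es"
proof -
  have "b * (\<Sum>i\<leftarrow>e. lookup (int_weights ws) i) \<le> a * sum_list (int_weights ws)"
    if "e \<in> set es" "\<forall>i\<in>set e. \<sigma> i" for e
  proof -
    have v: "valid_edge n e" using edges[OF that(1)] by (simp add: n_def)
    have "(\<Sum>i\<leftarrow>e. lookup (int_weights ws) i) = (\<Sum>i\<in>set e. wt i)"
      using v by (rule sum_lookup_int_weights)
    also have "\<dots> \<le> sum wt {i. i < n \<and> \<sigma> i}"
      using v that(2) by (intro sum_mono2) (auto simp: valid_edge_def)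
    finally show ?thesis
      using assms unfolding W_def by (meson le_trans mult_le_mono2)
  qed
  then show ?thesis
    unfolding les_def light_edges_def filter_filter by (intro filter_cong) auto
qed

section \<open>Rounding a vertex set of the cloud graph\<close>

definition "Z = 8 * h * Q"
definition "A = a * n * Z"

definition "bits S = map (\<lambda>v. if v \<in> S then 1 else 0 :: nat) [0..<Q]"
definition "y S = slot_counts b ws (bits S)"
definition "z S = rounded a b h ws es (bits S)"

lemma Z_pos: "Z > 0"
  using Q_pos h_pos by (simp add: Z_def)

lemma A_pos: "A > 0"
  using Z_pos a_pos n_pos by (simp add: A_def)

lemma z_eq: "z S = foldl (round_step A Z h ns les) (y S) [0..<n]"
  by (simp add: z_def rounded_def Let_def A_def Z_def Q_def n_def ns_def les_def y_def)

lemma length_y [simp]: "length (y S) = n"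
  by (simp add: y_def slot_counts_def n_def)

lemma y_nth:
  assumes "i < n"
  shows "y S ! i = card {t. t < Q \<and> cloud_copy ns i t \<in> S}"
proof -
  have lt: "cloud_copy ns i t < Q" for t
    using cloud_copy_in_cloud[of i ns t] cloud_subset_Q[of i] ns_pos[of i] assms by auto
  have "y S ! i = (\<Sum>t\<leftarrow>[0..<Q]. lookup (bits S) (cloud_copy ns i t))"
    using assms by (simp add: y_def slot_counts_def slots_def Q_def n_def ns_def)
  also have "\<dots> = (\<Sum>t\<leftarrow>[0..<Q]. if cloud_copy ns i t \<in> S then 1 else 0)"
    by (simp add: lookup_eq_nth bits_def lt)
  also have "\<dots> = length (filter (\<lambda>t. cloud_copy ns i t \<in> S) [0..<Q])"
    by (simp only: sum_list_if_const mult_1)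
  also have "\<dots> = card {t. t < Q \<and> cloud_copy ns i t \<in> S}"
    by (simp add: length_filter_conv_card) (rule arg_cong[of _ _ card], auto)
  finally show ?thesis .
qed

lemma y_less_Z:
  assumes "i < n"
  shows "y S ! i < Z"
proof -
  have "y S ! i \<le> card {..<Q}"
    unfolding y_nth[OF assms] by (intro card_mono) auto
  also have "card {..<Q} < Z" using Q_pos h_pos by (simp add: Z_def)
  finally show ?thesis .
qed

lemma edge_prod_y: "e \<in> set les \<Longrightarrow> edge_prod (y S) e = slot_prod S e"
  unfolding edge_prod_def slot_prod_def using les_edges[of e]
  by (intro arg_cong[of _ _ prod_list] map_cong) (auto simp: valid_edge_def lookup_eq_nth y_nth)

lemma gain_y: "gain A les (y S) = A * (\<Sum>e\<leftarrow>les. slot_prod S e)"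
proof -
  have "gain A les (y S) = (\<Sum>e\<leftarrow>les. slot_prod S e * A)"
    unfolding gain_def by (intro arg_cong[of _ _ sum_list] map_cong) (auto simp: edge_prod_y)
  also have "\<dots> = (\<Sum>e\<leftarrow>les. slot_prod S e) * A"
    by (rule sum_list_mult_const)
  finally show ?thesis by (simp only: mult.commute)
qed

text \<open>This is where 8 comes from: the total is at most \<open>2 * Q\<close> per element of
  \<open>S\<close>, hence \<open>4 * Q * a * n\<close>, and \<open>2 * h\<close> times this is
  exactly \<open>A\<close>.\<close>

lemma outer_weight_y_le:
  assumes "S \<subseteq> {..<Q}" "card S = 2 * a * n"
  shows "2 * (h * outer_weight ns (y S) e) \<le> A"
proof -
  have fin: "finite S" using assms(1) finite_subset by blast
  have "outer_weight ns (y S) e = (\<Sum>j\<in>{..<n} - set e. ns ! j * y S ! j)"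
    by (simp add: outer_weight_eq)
  also have "\<dots> \<le> (\<Sum>j<n. ns ! j * y S ! j)"
    by (intro sum_mono2) auto
  also have "\<dots> \<le> (\<Sum>j<n. 2 * Q * card (S \<inter> cloud ns j))"
    using fin by (intro sum_mono) (auto simp: y_nth intro!: slots_in_set_le ns_pos ns_le_Q)
  also have "\<dots> = 2 * Q * (\<Sum>j<n. card (S \<inter> cloud ns j))"
    by (simp add: sum_distrib_left)
  also have "\<dots> \<le> 2 * Q * (2 * a * n)"
    using sum_card_cloud_le[OF fin, of ns] assms(2) by simp
  finally have "2 * (h * outer_weight ns (y S) e) \<le> 2 * (h * (2 * Q * (2 * a * n)))"
    by (intro mult_le_mono2)
  also have "\<dots> = A" by (simp add: A_def Z_def)
  finally show ?thesis .
qed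

lemma potential_y_ge:
  assumes "S \<subseteq> {..<Q}" "card S = 2 * a * n"
  shows "2 * potential A h ns les (y S) \<ge> int (gain A les (y S))"
proof -
  have "2 * (edge_prod (y S) e * (h * outer_weight ns (y S) e)) \<le> edge_prod (y S) e * A" for e
    using mult_left_mono[OF outer_weight_y_le[OF assms, of e], of "edge_prod (y S) e"]
    by (simp add: mult_ac)
  then have "2 * loss h ns les (y S) \<le> gain A les (y S)"
    unfolding loss_def gain_def sum_list_const_mult[symmetric] by (intro sum_list_mono)
  then show ?thesis by (simp add: potential_def)
qed

lemma rounding_result:
  "length (z S) = n" "\<forall>i<n. z S ! i \<in> {0, Z}"
  "potential A h ns les (y S) \<le> potential A h ns les (z S)"
  "potential A h ns les (y S) < potential A h ns les (z S) \<or> (\<forall>i<n. z S ! i = 0)"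
  using rounding_potential[where z = "y S" and es = les and ns = ns and Z = Z and A = A and h = h and m = n]
    les_edges y_less_Z by (auto simp: z_eq)

definition "out S i \<longleftrightarrow> z S ! i \<noteq> 0"

lemma decode_eq: "decode a b h ws es (bits S) = map (\<lambda>i. if out S i then 1 else 0) [0..<n]"
proof -
  have nz: "sum_list (int_weights ws) \<noteq> 0" using W_pos by (rule gr_implies_not0)
  show ?thesis
    unfolding decode_def if_not_P[OF nz] z_def[symmetric]
    using rounding_result(1)[of S] by (intro nth_equalityI) (auto simp: out_def)
qed

text \<open>Half of the initial gain survives in the initial potential, the rounding does not lower
  the potential, and the final potential is at most the final gain. There each labeled light
  hyperedge counts \<open>A * Z ^ r\<close>.\<close>

lemma slot_prod_le_output:
  assumes "S \<subseteq> {..<Q}" "card S = 2 * a * n"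
  shows "(\<Sum>e\<leftarrow>les. slot_prod S e) \<le> 2 * Z ^ r * length (filter (\<lambda>e. \<forall>i\<in>set e. out S i) es)"
proof -
  have "int (gain A les (y S)) \<le> 2 * potential A h ns les (z S)"
    using potential_y_ge[OF assms] rounding_result(3)[of S] by linarith
  also have "\<dots> \<le> 2 * int (gain A les (z S))"
    by (simp add: potential_def)
  finally have "gain A les (y S) \<le> 2 * gain A les (z S)" by linarith
  also have "gain A les (z S) = A * Z ^ r * length (filter (\<lambda>e. \<forall>i\<in>set e. out S i) les)"
    unfolding out_def using rounding_result(1,2)[of S] les_edges by (intro gain_zero_or_Z) auto
  finally have "gain A les (y S) \<le> A * (2 * Z ^ r * length (filter (\<lambda>e. \<forall>i\<in>set e. out S i) les))"
    by (simp only: mult_ac)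
  then have "(\<Sum>e\<leftarrow>les. slot_prod S e) \<le> 2 * Z ^ r * length (filter (\<lambda>e. \<forall>i\<in>set e. out S i) les)"
    using A_pos unfolding gain_y by simp
  also have "\<dots> \<le> 2 * Z ^ r * length (filter (\<lambda>e. \<forall>i\<in>set e. out S i) es)"
  proof (intro mult_left_mono)
    have eq: "filter (\<lambda>e. \<forall>i\<in>set e. out S i) les =
        filter (\<lambda>e. b * (\<Sum>i\<leftarrow>e. lookup (int_weights ws) i) \<le> a * sum_list (int_weights ws))
          (filter (\<lambda>e. \<forall>i\<in>set e. out S i) es)"
      unfolding les_def light_edges_def filter_filter by (intro filter_cong) auto
    show "length (filter (\<lambda>e. \<forall>i\<in>set e. out S i) les) \<le>
        length (filter (\<lambda>e. \<forall>i\<in>set e. out S i) es)"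
      by (subst eq) (rule length_filter_le)
  qed simp
  finally show ?thesis .
qed

text \<open>The certifying hyperedge weighs at most \<mu> W and the rest at most \<mu> W/h, which
  gives the factor (h + 1)/h.\<close>

lemma output_weight:
  assumes "S \<subseteq> {..<Q}" "card S = 2 * a * n"
  shows "h * b * sum wt {i. i < n \<and> out S i} \<le> (h + 1) * a * W"
proof (cases "\<forall>i<n. z S ! i = 0")
  \<comment> \<open>The potential may be 0 here, so there is no certificate, but the empty labeling
    weighs nothing.\<close>
  case True
  then have "{i. i < n \<and> out S i} = {}" by (auto simp: out_def)
  then show ?thesis by (simp only: sum.empty)
next
  case False
  then have "potential A h ns les (y S) < potential A h ns les (z S)"
    using rounding_result(4)[of S] by blast
  \<comment> \<open>The initial potential is at least half a gain, hence nonnegative; strict growth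
    makes it positive.\<close>
  then have "potential A h ns les (z S) > 0"
    using potential_y_ge[OF assms] by linarith
  then obtain e where e: "e \<in> set les" "\<forall>i\<in>set e. z S ! i \<noteq> 0" "h * outer_weight ns (z S) e < A"
    using potential_pos_imp_edge[of les "z S" A h ns] les_edges rounding_result(1) by auto
  have v: "set e \<subseteq> {..<n}" "b * sum wt (set e) \<le> a * W"
    using les_edges[OF e(1)] by (auto simp: valid_edge_def)
  let ?O = "{i. i < n \<and> out S i}"
  let ?R = "?O - set e"
  have "outer_weight ns (z S) e = (\<Sum>j\<in>{..<n} - set e. ns ! j * z S ! j)"
    using rounding_result(1) by (simp add: outer_weight_eq)
  also have "\<dots> = (\<Sum>j\<in>?R. ns ! j * Z)"
    using rounding_result(2)[of S]
    by (intro sum.mono_neutral_cong_right) (auto simp: out_def)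
  also have "\<dots> = (\<Sum>j\<in>?R. ns ! j) * Z"
    by (simp add: sum_distrib_right)
  \<comment> \<open>Rounded entries are 0 or \<open>Z\<close>, so the common factor \<open>Z\<close>
    cancels and a bound on cloud sizes remains.\<close>
  finally have "h * (\<Sum>j\<in>?R. ns ! j) * Z < a * n * Z"
    using e(3) by (simp only: A_def mult.assoc)
  then have R: "h * (\<Sum>j\<in>?R. ns ! j) \<le> a * n"
    by (simp only: mult_less_cancel2 less_imp_le)
  have "sum wt ?R * (b * n) \<le> (\<Sum>j\<in>?R. ns ! j) * W"
    unfolding sum_distrib_right by (intro sum_mono wt_le_ns) auto
  then have "h * (sum wt ?R * (b * n)) \<le> h * ((\<Sum>j\<in>?R. ns ! j) * W)"
    by (rule mult_le_mono2)
  also have "\<dots> = h * (\<Sum>j\<in>?R. ns ! j) * W" by (rule mult.assoc[symmetric])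
  also have "\<dots> \<le> a * n * W"
    using R by (rule mult_le_mono1)
  finally have "n * (h * b * sum wt ?R) \<le> n * (a * W)"
    by (simp only: mult_ac)
  then have "h * b * sum wt ?R \<le> a * W" using n_pos by (simp only: nat_mult_le_cancel1)
  moreover have "h * b * sum wt (set e) \<le> h * (a * W)"
    using mult_le_mono2[OF v(2), of h] by (simp only: mult.assoc)
  ultimately have "h * b * sum wt ?R + h * b * sum wt (set e) \<le> a * W + h * (a * W)"
    by (rule add_mono)
  also have "\<dots> = (h + 1) * a * W" by (simp add: algebra_simps)
  also have "h * b * sum wt ?R + h * b * sum wt (set e) = h * b * (sum wt ?R + sum wt (set e))"
    by (rule distrib_left[symmetric])
  also have "sum wt ?R + sum wt (set e) = sum wt ?O"
    using v(1) e(2) by (intro sum.subset_diff[symmetric]) (auto simp: out_def)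
  finally show ?thesis .
qed

end

section \<open>Values, optima and encodings of instances\<close>

lemma Val_eq_length_filter:
  assumes "hyperedges G = mset (map set es)"
  shows "Val G \<sigma> = real (length (filter (\<lambda>e. \<forall>i\<in>set e. \<sigma> i) es)) / real (length es)"
proof -
  have "filter_mset (\<lambda>e. \<forall>i\<in>e. \<sigma> i) (mset (map set es)) =
      mset (map set (filter (\<lambda>e. \<forall>i\<in>set e. \<sigma> i) es))"
    by (induction es) auto
  then show ?thesis
    unfolding Val_def assms by (simp only: size_mset length_map)
qed

lemma Val_nonneg: "0 \<le> Val G \<sigma>"
  by (simp add: Val_def)

text \<open>There are infinitely many labelings \<open>nat \<Rightarrow> bool\<close>, but values
  are fractions with one fixed denominator, so each \<open>Max\<close> is over a finite set.\<close>

lemma finite_range_Val: "finite (range (Val G))"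
proof (rule finite_subset)
  show "range (Val G) \<subseteq> (\<lambda>k. real k / real (size (hyperedges G))) ` {..size (hyperedges G)}"
    by (auto simp: Val_def intro!: imageI size_filter_mset_lesseq)
qed simp

lemma Val_le_attained:
  assumes "0 \<le> \<mu>"
  obtains \<sigma> where "rel_weight H \<sigma> \<le> \<mu>" "Val_le \<mu> H = Val H \<sigma>"
proof -
  let ?V = "{Val H \<sigma> |\<sigma>. rel_weight H \<sigma> \<le> \<mu>}"
  have "finite ?V"
    by (rule finite_subset[OF _ finite_range_Val[of H]]) auto
  moreover have "rel_weight H (\<lambda>_. False) \<le> \<mu>"
    using assms by (simp add: rel_weight_def)
  then have "?V \<noteq> {}" by blast
  ultimately have "Max ?V \<in> ?V" by (rule Max_in)
  then show ?thesis using that unfolding Val_le_def by blast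
qed

lemma DkSH_opt_ge:
  assumes "T \<subseteq> {..<num_verts G}" "card T = k"
  shows "Val G (\<lambda>i. i \<in> T) \<le> DkSH_opt G k"
  unfolding DkSH_opt_def
proof (rule Max_ge)
  show "finite {Val G (\<lambda>i. i \<in> S) |S. S \<subseteq> {..<num_verts G} \<and> card S = k}"
    by (rule finite_subset[OF _ finite_range_Val[of G]]) auto
qed (use assms in blast)

lemma enc_labeling_eq: "enc_labeling n \<pi> = encode (map (\<lambda>i. if \<pi> i then 1 else 0 :: nat) [0..<n])"
  by (simp add: enc_labeling_def encode_list_def encode_nat_def comp_def)

lemma encode_nat_list: "encode ns = enc_list (map Atom ns)"
  by (induction ns) (auto simp: enc_list_def encode_nat_def)

lemma encode_edges: "encode es = enc_list (map (\<lambda>e. enc_list (map Atom e)) es)"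
  by (induction es) (auto simp: enc_list_def encode_nat_list)

definition cloud_graph :: "nat \<Rightarrow> nat \<Rightarrow> nat \<Rightarrow> (nat \<times> nat) list \<Rightarrow> nat list list \<Rightarrow> hypergraph" where
  "cloud_graph r a b ws es =
     \<lparr>num_verts = 2 * b * length ws, hyperedges = mset (map set (cloud_edges r a b ws es))\<rparr>"

context weighted_instance
begin

lemma uniform_cloud_graph: "uniform r (cloud_graph r a b ws es)"
  using cloud_edges_valid
  by (auto simp: uniform_def cloud_graph_def valid_edge_def Q_def n_def distinct_card)

lemma enc_cloud_graph:
  "enc_unweighted (cloud_graph r a b ws es, 2 * a * length ws)
     (encode (slots b ws, cloud_edges r a b ws es, 2 * a * length ws))"
  unfolding enc_unweighted_def prod.case
proof (intro exI conjI)
  show "enc_edges (hyperedges (cloud_graph r a b ws es)) (encode (cloud_edges r a b ws es))"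
    unfolding enc_edges_def
    by (rule exI[of _ "cloud_edges r a b ws es"])
      (use cloud_edges_valid in \<open>auto simp: cloud_graph_def encode_edges valid_edge_def\<close>)
qed (simp add: cloud_graph_def slots_def encode_nat_list encode_nat_def)

text \<open>Counts are compared instead of values, because the cloud graph normalises by the light
  hyperedges only and the instance by all of them.\<close>

lemma approximation_transfer:
  assumes S: "S \<subseteq> {..<Q}" "card S = 2 * a * n" and "a \<le> b" "\<alpha> \<ge> 0"
    and approx: "Val (cloud_graph r a b ws es) (\<lambda>i. i \<in> S) \<ge> \<alpha> * DkSH_opt (cloud_graph r a b ws es) (2 * a * n)"
    and \<sigma>: "b * sum wt {i. i < n \<and> \<sigma> i} \<le> a * W"
  shows "\<alpha> * real (length (filter (\<lambda>e. \<forall>i\<in>set e. \<sigma> i) es)) \<le>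
    2 * (8 * real h) ^ r * real (length (filter (\<lambda>e. \<forall>i\<in>set e. out S i) es))"
\<comment> \<open>Without light hyperedges the cloud graph has no hyperedges and its values carry no
  information, but then \<open>\<sigma>\<close> contains no hyperedge either.\<close>
proof (cases "les = []")
  case True
  then have "filter (\<lambda>e. \<forall>i\<in>set e. \<sigma> i) es = []"
    using light_if_labeled[OF \<sigma>] by simp
  then show ?thesis by (simp only: list.size) simp
next
  case False
  let ?G = "cloud_graph r a b ws es"
  let ?in = "\<lambda>U. length (filter (\<lambda>e. \<forall>v\<in>set e. v \<in> U) (cloud_edges r a b ws es))"
  let ?N = "length (filter (\<lambda>e. \<forall>i\<in>set e. \<sigma> i) es)"
  let ?M = "length (filter (\<lambda>e. \<forall>i\<in>set e. out S i) es)"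
  have E: "real (length (cloud_edges r a b ws es)) > 0"
    using False Q_pos by (simp add: length_cloud_edges)
  have Val: "Val ?G (\<lambda>i. i \<in> U) * real (length (cloud_edges r a b ws es)) = real (?in U)" for U
    using E by (subst Val_eq_length_filter[of _ "cloud_edges r a b ws es"]) (simp_all add: cloud_graph_def)
  obtain T where T: "T \<subseteq> {..<Q}" "card T = 2 * a * n"
    "length (filter (\<lambda>e. \<forall>i\<in>set e. \<sigma> i) les) * Q ^ r \<le> ?in T"
    using lift_labeling[OF \<sigma> \<open>a \<le> b\<close>] by blast
  have "\<alpha> * (real ?N * real Q ^ r) \<le> \<alpha> * real (?in T)"
    using T(3) \<open>\<alpha> \<ge> 0\<close> unfolding light_if_labeled[OF \<sigma>]
    by (intro mult_left_mono) (simp_all flip: of_nat_power of_nat_mult)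
  also have "\<dots> = \<alpha> * Val ?G (\<lambda>i. i \<in> T) * real (length (cloud_edges r a b ws es))"
    by (simp only: Val mult.assoc)
  also have "\<dots> \<le> \<alpha> * DkSH_opt ?G (2 * a * n) * real (length (cloud_edges r a b ws es))"
    using \<open>\<alpha> \<ge> 0\<close> T(1,2)
    by (intro mult_right_mono mult_left_mono DkSH_opt_ge) (auto simp: cloud_graph_def Q_def n_def)
  also have "\<dots> \<le> Val ?G (\<lambda>i. i \<in> S) * real (length (cloud_edges r a b ws es))"
    using approx by (intro mult_right_mono) auto
  also have "\<dots> = real (\<Sum>e\<leftarrow>les. slot_prod S e)"
    by (simp only: Val count_cloud_edges)
  also have "\<dots> \<le> real (2 * Z ^ r * ?M)"
    using slot_prod_le_output[OF S] by (simp only: of_nat_le_iff)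
  \<comment> \<open>\<open>Z = 8 * h * Q\<close>, so dividing by the \<open>Q ^ r\<close> copies per
    hyperedge leaves the damping factor \<open>(8 * h) ^ r\<close>.\<close>
  also have "\<dots> = (2 * (8 * real h) ^ r * real ?M) * real Q ^ r"
    by (simp add: Z_def power_mult_distrib)
  finally have "(\<alpha> * real ?N) * real Q ^ r \<le> (2 * (8 * real h) ^ r * real ?M) * real Q ^ r"
    by (simp only: mult.assoc)
  then show ?thesis
    using Q_pos by (simp only: mult_le_cancel_right_pos zero_less_power of_nat_0_less_iff)
qed

end

text \<open>\<open>B\<close> is only guaranteed on prepared inputs and its answer is one of many
  acceptable ones, hence the set \<open>X\<close> and the relation \<open>good\<close>. The input is
  kept next to the answer for \<open>post\<close>.\<close>

lemma exec_with_oracle: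
  fixes pre :: "'a::encodable \<Rightarrow> 'b::encodable" and post :: "'c::encodable \<times> 'a \<Rightarrow> 'd::encodable"
  assumes pre: "poly_time pre" and post: "poly_time post"
    and B: "\<And>x. x \<in> X \<Longrightarrow> \<exists>t y. exec B (encode (pre x)) t (encode y) \<and> t \<le> poly q (esize (pre x)) \<and> good x y"
  shows "\<exists>A (p::nat poly). \<forall>x\<in>X. \<exists>t y. exec A (encode x) t (encode (post (y, x))) \<and>
    t \<le> poly p (esize x) \<and> good x y"
proof -
  from pre obtain P p where P: "\<And>x. \<exists>t. exec P (encode x) t (encode (pre x)) \<and> t \<le> poly p (esize x)"
    unfolding poly_time_def by blast
  from post obtain D d where D: "\<And>x. \<exists>t. exec D (encode x) t (encode (post x)) \<and> t \<le> poly d (esize x)"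
    unfolding poly_time_def by blast
  define A where "A = Seq (Fork (Seq P B) (Prim Id)) D"
  \<comment> \<open>\<open>s\<close> bounds the cost of the \<open>Fork\<close>: three unit charges,
    three times the input size, the preparation, and \<open>B\<close> on an input of size at most
    \<open>p\<close>.\<close>
  define s where "s = [:3, 3:] + p + pcompose q p"
  have "\<exists>t y. exec A (encode x) t (encode (post (y, x))) \<and>
      t \<le> poly ([:1:] + s + pcompose d s) (esize x) \<and> good x y" if x: "x \<in> X" for x
  proof -
    obtain t where t: "exec P (encode x) t (encode (pre x))" "t \<le> poly p (esize x)"
      using P by blast
    obtain u y where u: "exec B (encode (pre x)) u (encode y)" "u \<le> poly q (esize (pre x))" "good x y"
      using B[OF x] by blast
    have "esize (pre x) \<le> poly p (esize x)"
      using exec_output_size[OF t(1)] t(2) by simp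
    then have u': "u \<le> poly q (poly p (esize x))"
      using u(2) poly_nat_mono le_trans by blast
    have f: "exec (Fork (Seq P B) (Prim Id)) (encode x)
        (1 + esize x + (1 + t + u) + (1 + esize x + esize x)) (encode (y, x))"
      unfolding encode_Pair by (intro exec.Fork exec.Seq[OF t(1) u(1)] exec_Prim') simp
    have f_le: "1 + esize x + (1 + t + u) + (1 + esize x + esize x) \<le> poly s (esize x)"
      using t(2) u' by (simp add: s_def poly_pcompose)
    obtain v where v: "exec D (encode (y, x)) v (encode (post (y, x)))" "v \<le> poly d (esize (y, x))"
      using D by blast
    have "esize (y, x) \<le> poly s (esize x)"
      using exec_output_size[OF f] f_le by simp
    then have "v \<le> poly d (poly s (esize x))"
      using v(2) poly_nat_mono le_trans by blast
    then have "1 + (1 + esize x + (1 + t + u) + (1 + esize x + esize x)) + v \<le>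
        poly ([:1:] + s + pcompose d s) (esize x)"
      using f_le by (simp add: poly_pcompose)
    then show ?thesis
      using exec.Seq[OF f v(1)] u(3) unfolding A_def by blast
  qed
  then show ?thesis by blast
qed

text \<open>Returning the first k vertices achieves factor 0, so the set whose supremum is
  \<open>alpha_uw\<close> is nonempty.\<close>

lemma approximates_DkSH_trivial:
  assumes "\<mu> \<le> 1"
  shows "\<exists>B. approximates_DkSH B \<mu> r 0"
proof -
  have "poly_time (\<lambda>x::nat list \<times> nat list list \<times> nat.
      map (\<lambda>v. if v < snd (snd x) then 1 else 0 :: nat) (fst x))"
    by (intro poly_time_intros)
  then obtain B p where B: "\<And>x::nat list \<times> nat list list \<times> nat. \<exists>t. exec B (encode x) t
      (encode (map (\<lambda>v. if v < snd (snd x) then 1 else 0 :: nat) (fst x))) \<and> t \<le> poly p (esize x)"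
    unfolding poly_time_def by blast
  have "\<exists>t y. exec B x t y \<and> t \<le> poly p (tree_size x) \<and>
      (\<exists>S\<subseteq>{..<num_verts G}. card S = k \<and> y = enc_labeling (num_verts G) (\<lambda>i. i \<in> S) \<and>
        0 * DkSH_opt G k \<le> Val G (\<lambda>i. i \<in> S))"
    if k: "of_nat k = \<mu> * of_nat (num_verts G)" and x: "enc_unweighted (G, k) x"
    for G :: hypergraph and k x
  proof -
    have "(of_nat k :: rat) \<le> of_nat (num_verts G)"
      unfolding k using mult_right_mono[OF assms, of "of_nat (num_verts G)"] by simp
    then have k_le: "k \<le> num_verts G" by simp
    from x obtain es where "x = Node (enc_list (map Atom [0..<num_verts G]))
        (Node (enc_list (map (\<lambda>e. enc_list (map Atom e)) es)) (Atom k))"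
      unfolding enc_unweighted_def enc_edges_def by auto
    then have "x = encode ([0..<num_verts G], es, k)"
      by (simp only: encode_Pair encode_nat_list encode_edges encode_nat_def)
    then obtain t where t: "exec B x t (encode (map (\<lambda>v. if v < k then 1 else 0 :: nat) [0..<num_verts G]))"
        "t \<le> poly p (tree_size x)"
      using B[of "([0..<num_verts G], es, k)"] by auto
    have "encode (map (\<lambda>v. if v < k then 1 else 0 :: nat) [0..<num_verts G]) =
        enc_labeling (num_verts G) (\<lambda>i. i \<in> {..<k})"
      by (simp add: enc_labeling_eq)
    moreover have "{..<k} \<subseteq> {..<num_verts G}" "card {..<k} = k"
      "0 * DkSH_opt G k \<le> Val G (\<lambda>i. i \<in> {..<k})"
      using k_le by (auto simp: Val_nonneg)
    ultimately show ?thesis using t by blast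
  qed
  then have "approximates_DkSH B \<mu> r 0"
    unfolding approximates_DkSH_def solves_in_poly_time_def by (intro exI[of _ p]) auto
  then show ?thesis by blast
qed

text \<open>The supremum need not be attained by one algorithm. A factor of at least half of it is,
  and the 2 goes into the constant.\<close>

lemma alpha_uw_approximated:
  assumes "\<mu> \<le> 1"
  obtains B a where "approximates_DkSH B \<mu> r a" "0 \<le> a" "alpha_uw \<mu> r \<le> 2 * a"
proof -
  let ?X = "{a. 0 \<le> a \<and> a \<le> 1 \<and> (\<exists>B. approximates_DkSH B \<mu> r a)}"
  have 0: "0 \<in> ?X" using approximates_DkSH_trivial[OF assms] by simp
  have bdd: "bdd_above ?X" by (intro bdd_aboveI[of _ 1]) auto
  show ?thesis
  proof (cases "alpha_uw \<mu> r \<le> 0")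
    case True
    with 0 show ?thesis using that[of _ 0] by auto
  next
    case False
    then have "alpha_uw \<mu> r / 2 < Sup ?X" unfolding alpha_uw_def by simp
    then obtain a where "a \<in> ?X" "alpha_uw \<mu> r / 2 < a"
      using less_cSup_iff[OF _ bdd] 0 by blast
    then show ?thesis using that[of _ a] by auto
  qed
qed

lemma alpha_uw_bounds:
  assumes "\<mu> \<le> 1"
  shows "0 \<le> alpha_uw \<mu> r" "alpha_uw \<mu> r \<le> 1"
proof -
  let ?X = "{a. 0 \<le> a \<and> a \<le> 1 \<and> (\<exists>B. approximates_DkSH B \<mu> r a)}"
  have 0: "0 \<in> ?X" using approximates_DkSH_trivial[OF assms] by simp
  have "bdd_above ?X" by (intro bdd_aboveI[of _ 1]) auto
  with 0 show "0 \<le> alpha_uw \<mu> r" unfolding alpha_uw_def by (intro cSup_upper)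
  show "alpha_uw \<mu> r \<le> 1" unfolding alpha_uw_def
    by (rule cSup_least) (use 0 in blast)+
qed

section \<open>Clearing the denominators of rational weights\<close>

definition rat_pair :: "rat \<Rightarrow> nat \<times> nat" where
  "rat_pair q = (nat (fst (quotient_of q)), nat (snd (quotient_of q)))"

lemma enc_rat_eq: "enc_rat q = encode (rat_pair q)"
  by (simp add: enc_rat_def rat_pair_def encode_nat_def split: prod.split)

lemma rat_pair_nonneg:
  assumes "0 \<le> q"
  shows "snd (rat_pair q) > 0" "q = of_nat (fst (rat_pair q)) / of_nat (snd (rat_pair q))"
proof -
  obtain c d where cd: "quotient_of q = (c, d)" by (rule prod.exhaust)
  have d: "d > 0" using quotient_of_denom_pos[OF cd] .
  have q: "q = of_int c / of_int d" using quotient_of_div[OF cd] .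
  have "c \<ge> 0" using assms d unfolding q by (simp add: zero_le_divide_iff)
  then show "snd (rat_pair q) > 0" "q = of_nat (fst (rat_pair q)) / of_nat (snd (rat_pair q))"
    using d by (simp_all add: rat_pair_def cd) (simp add: q)
qed

lemma denom_prod_pos:
  assumes "\<And>w. w \<in> set ws \<Longrightarrow> snd w > 0"
  shows "denom_prod ws > 0"
  using assms by (induction ws) (auto simp: denom_prod_def)

text \<open>Each denominator divides the product of all, so the natural-number division in
  \<open>int_weights\<close> is exact.\<close>

lemma int_weights_nth:
  assumes "\<And>w. w \<in> set ws \<Longrightarrow> snd w > 0" "i < length ws"
  shows "of_nat (int_weights ws ! i) =
    (of_nat (fst (ws ! i)) / of_nat (snd (ws ! i)) * of_nat (denom_prod ws) :: rat)"
proof -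
  have "snd (ws ! i) dvd denom_prod ws"
    unfolding denom_prod_def using assms(2) by (intro prod_list_dvd) auto
  then have "(of_nat (denom_prod ws div snd (ws ! i)) :: rat) = of_nat (denom_prod ws) / of_nat (snd (ws ! i))"
    by (rule of_nat_of_nat_div)
  then show ?thesis using assms(2) by (simp add: int_weights_def)
qed

text \<open>All weights are scaled by the same positive factor, which cancels in the quotient; if
  the total is 0, both sides are 0.\<close>

lemma rel_weight_int_weights:
  assumes "ws = map (\<lambda>i. rat_pair (weight H i)) [0..<num_verts H]" "\<forall>i<num_verts H. 0 \<le> weight H i"
  shows "rel_weight H \<sigma> = of_nat (\<Sum>i\<in>{i. i < num_verts H \<and> \<sigma> i}. int_weights ws ! i) /
    of_nat (sum_list (int_weights ws))"
proof -
  let ?D = "of_nat (denom_prod ws) :: rat"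
  have pos: "snd w > 0" if "w \<in> set ws" for w
    using that assms rat_pair_nonneg by auto
  have D: "?D > 0" using denom_prod_pos[of ws] pos by simp
  have w: "of_nat (int_weights ws ! i) = weight H i * ?D" if "i < num_verts H" for i
    using int_weights_nth[of ws i] pos that assms rat_pair_nonneg(2)[of "weight H i"] by simp
  have "of_nat (\<Sum>i\<in>{i. i < num_verts H \<and> \<sigma> i}. int_weights ws ! i) =
      (\<Sum>i\<in>{i. i < num_verts H \<and> \<sigma> i}. weight H i) * ?D"
    by (simp add: w sum_distrib_right)
  moreover have "of_nat (sum_list (int_weights ws)) = (\<Sum>i<num_verts H. weight H i) * ?D"
  proof -
    have "sum_list (int_weights ws) = (\<Sum>i<num_verts H. int_weights ws ! i)"
      using assms(1) by (simp add: sum_list_sum_nth atLeast0LessThan int_weights_def)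
    then show ?thesis by (simp add: w sum_distrib_right)
  qed
  ultimately show ?thesis using D by (simp add: rel_weight_def)
qed


text \<open>With total weight 0 the cloud sizes would divide by zero. The empty instance is sent
  instead, so that the input is valid in every case.\<close>

definition reduction ::
    "nat \<Rightarrow> nat \<Rightarrow> nat \<Rightarrow> (nat \<times> nat) list \<Rightarrow> nat list list \<Rightarrow> nat list \<times> nat list list \<times> nat" where
  "reduction r a b ws es =
     (if sum_list (int_weights ws) = 0 then ([], [], 0)
      else (slots b ws, cloud_edges r a b ws es, 2 * a * length ws))"

lemma poly_time_reduction:
  assumes "poly_time ws" "poly_time es"
  shows "poly_time (\<lambda>x. reduction r a b (ws x) (es x))"
  unfolding reduction_def by (intro poly_time_intros assms)

text \<open>For total weight 0 nothing is demanded, since \<open>decode\<close> then ignores the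
  answer.\<close>

definition good_answer ::
    "nat \<Rightarrow> nat \<Rightarrow> nat \<Rightarrow> real \<Rightarrow> (nat \<times> nat) list \<Rightarrow> nat list list \<Rightarrow> nat list \<Rightarrow> bool" where
  "good_answer r a b \<alpha> ws es bits \<longleftrightarrow>
     (sum_list (int_weights ws) > 0 \<longrightarrow>
       (\<exists>S\<subseteq>{..<2 * b * length ws}. card S = 2 * a * length ws \<and>
         bits = map (\<lambda>v. if v \<in> S then 1 else 0) [0..<2 * b * length ws] \<and>
         Val (cloud_graph r a b ws es) (\<lambda>i. i \<in> S) \<ge>
           \<alpha> * DkSH_opt (cloud_graph r a b ws es) (2 * a * length ws)))"

text \<open>\<open>q\<close> is the place of the encoded bias in the input; \<open>a\<close>,
  \<open>b\<close>, \<open>h\<close> and \<open>r\<close> are built into the program, and the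
  polynomial may depend on them.\<close>

lemma weighted_algorithm:
  fixes a b h r :: nat
  assumes B: "approximates_DkSH B (of_nat a / of_nat b) r \<alpha>" and pos: "a > 0" "b > 0" "h > 0"
  shows "\<exists>A (p::nat poly). \<forall>ws es q. (\<forall>e\<in>set es. valid_edge (length ws) e \<and> length e = r) \<longrightarrow>
    (\<exists>t bits. exec A (encode (ws, es, q :: nat \<times> nat)) t (encode (decode a b h ws es bits)) \<and>
      t \<le> poly p (esize (ws, es, q)) \<and>
      good_answer r a b \<alpha> ws es bits)"
proof -
  define X where "X = {(ws :: (nat \<times> nat) list, es, q :: nat \<times> nat).
    \<forall>e\<in>set es. valid_edge (length ws) e \<and> length e = r}"
  from B obtain p where p: "\<And>G k x. uniform r G \<Longrightarrow> of_nat k = of_nat a / of_nat b * (of_nat (num_verts G) :: rat) \<Longrightarrow>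
      enc_unweighted (G, k) x \<Longrightarrow> \<exists>t y. exec B x t y \<and> t \<le> poly p (tree_size x) \<and>
        (\<exists>S\<subseteq>{..<num_verts G}. card S = k \<and> y = enc_labeling (num_verts G) (\<lambda>i. i \<in> S) \<and>
          Val G (\<lambda>i. i \<in> S) \<ge> \<alpha> * DkSH_opt G k)"
    unfolding approximates_DkSH_def solves_in_poly_time_def split_paired_All prod.case by blast
  have "\<exists>A (p::nat poly). \<forall>x\<in>X. \<exists>t bits. exec A (encode x) t
      (encode ((\<lambda>yx. decode a b h (fst (snd yx)) (fst (snd (snd yx))) (fst yx)) (bits, x))) \<and>
      t \<le> poly p (esize x) \<and> good_answer r a b \<alpha> (fst x) (fst (snd x)) bits"
  proof (rule exec_with_oracle)
    show "poly_time (\<lambda>x :: (nat \<times> nat) list \<times> nat list list \<times> nat \<times> nat. reduction r a b (fst x) (fst (snd x)))"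
      by (intro poly_time_reduction poly_time_intros)
    show "poly_time (\<lambda>yx :: nat list \<times> (nat \<times> nat) list \<times> nat list list \<times> nat \<times> nat.
        decode a b h (fst (snd yx)) (fst (snd (snd yx))) (fst yx))"
      by (intro poly_time_decode poly_time_intros)
  next
    fix x assume "x \<in> X"
    then obtain ws es q where x: "x = (ws, es, q)"
      and es: "\<And>e. e \<in> set es \<Longrightarrow> valid_edge (length ws) e \<and> length e = r"
      by (auto simp: X_def)
    show "\<exists>t y. exec B (encode (reduction r a b (fst x) (fst (snd x)))) t (encode y) \<and>
        t \<le> poly p (esize (reduction r a b (fst x) (fst (snd x)))) \<and>
        good_answer r a b \<alpha> (fst x) (fst (snd x)) y"
    proof (cases "sum_list (int_weights ws) = 0")
      case True
      \<comment> \<open>On the empty graph \<open>k = 0\<close> satisfies the bias equation, so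
        \<open>B\<close> must halt there within its time bound.\<close>
      let ?G = "\<lparr>num_verts = 0, hyperedges = {#}\<rparr> :: hypergraph"
      have red: "reduction r a b (fst x) (fst (snd x)) = ([], [], 0)"
        unfolding reduction_def x fst_conv snd_conv if_P[OF True] ..
      have "enc_unweighted (?G, 0) (encode ([] :: nat list, [] :: nat list list, 0 :: nat))"
        by (simp add: enc_unweighted_def enc_edges_def enc_list_def encode_nat_def)
      moreover have "uniform r ?G" by (simp add: uniform_def)
      moreover have "of_nat 0 = of_nat a / of_nat b * (of_nat (num_verts ?G) :: rat)" by simp
      ultimately obtain t S where t:
        "exec B (encode ([] :: nat list, [] :: nat list list, 0 :: nat)) t
          (enc_labeling (num_verts ?G) (\<lambda>i. i \<in> S))"
        "t \<le> poly p (esize ([] :: nat list, [] :: nat list list, 0 :: nat))"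
        using p by blast
      have "enc_labeling (num_verts ?G) (\<lambda>i. i \<in> S) = encode ([] :: nat list)"
        by (simp add: enc_labeling_eq)
      moreover have "good_answer r a b \<alpha> (fst x) (fst (snd x)) []"
        unfolding good_answer_def x fst_conv True by simp
      ultimately show ?thesis
        unfolding red using t by (intro exI[of _ t] exI[of _ "[]"]) simp
    next
      case False
      then interpret weighted_instance ws es a b h r
        using pos es by unfold_locales (simp_all only: neq0_conv)
      have red: "reduction r a b (fst x) (fst (snd x)) =
          (slots b ws, cloud_edges r a b ws es, 2 * a * length ws)"
        unfolding reduction_def x using False by (simp only: fst_conv snd_conv if_False)
      have "of_nat (2 * a * length ws) =
          of_nat a / of_nat b * (of_nat (num_verts (cloud_graph r a b ws es)) :: rat)"
        using pos by (simp add: cloud_graph_def field_simps)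
      from p[OF uniform_cloud_graph this enc_cloud_graph]
      obtain t S where t: "exec B (encode (slots b ws, cloud_edges r a b ws es, 2 * a * length ws)) t
          (enc_labeling (num_verts (cloud_graph r a b ws es)) (\<lambda>i. i \<in> S))"
        "t \<le> poly p (esize (slots b ws, cloud_edges r a b ws es, 2 * a * length ws))"
        and S: "S \<subseteq> {..<num_verts (cloud_graph r a b ws es)}" "card S = 2 * a * length ws"
        "Val (cloud_graph r a b ws es) (\<lambda>i. i \<in> S) \<ge>
          \<alpha> * DkSH_opt (cloud_graph r a b ws es) (2 * a * length ws)"
        by blast
      have nv: "num_verts (cloud_graph r a b ws es) = 2 * b * length ws"
        by (simp add: cloud_graph_def)
      have "good_answer r a b \<alpha> (fst x) (fst (snd x))
          (map (\<lambda>v. if v \<in> S then 1 else 0) [0..<2 * b * length ws])"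
        unfolding good_answer_def x fst_conv snd_conv using S[unfolded nv] by blast
      then show ?thesis
        unfolding red using t[unfolded nv enc_labeling_eq] by blast
    qed
  qed
  then obtain A and p' :: "nat poly" where A: "\<And>x. x \<in> X \<Longrightarrow> \<exists>t bits. exec A (encode x) t
      (encode (decode a b h (fst x) (fst (snd x)) bits)) \<and> t \<le> poly p' (esize x) \<and> good_answer r a b \<alpha> (fst x) (fst (snd x)) bits"
    by (elim exE) (simp only: fst_conv snd_conv Ball_def, blast)
  show ?thesis
  proof (intro exI[of _ A] exI[of _ p'] allI impI)
    fix ws :: "(nat \<times> nat) list" and es and q :: "nat \<times> nat"
    assume "\<forall>e\<in>set es. valid_edge (length ws) e \<and> length e = r"
    then have "(ws, es, q) \<in> X" unfolding X_def by blast
    from A[OF this] show "\<exists>t bits. exec A (encode (ws, es, q)) t (encode (decode a b h ws es bits)) \<and>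
      t \<le> poly p' (esize (ws, es, q)) \<and>
      good_answer r a b \<alpha> ws es bits"
      unfolding fst_conv snd_conv .
  qed
qed

text \<open>The ceiling gives 1 \<le> h\<eta> \<le> 1 + \<eta> \<le> 2: the lower bound controls the
  weight, the upper one the loss in value.\<close>

lemma eta_power_bound:
  fixes \<eta> :: real
  assumes "0 < \<eta>" "\<eta> < 1"
  defines "h \<equiv> nat \<lceil>1 / \<eta>\<rceil>"
  shows "h > 0" "1 \<le> real h * \<eta>" "(8 * real h) ^ r * \<eta> ^ r \<le> 16 ^ r"
proof -
  have "1 / \<eta> \<le> real h" unfolding h_def by (rule real_nat_ceiling_ge)
  then show 1: "1 \<le> real h * \<eta>" using assms(1) by (simp only: pos_divide_le_eq)
  then show "h > 0" by (cases "h = 0") auto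
  have "real h \<le> 1 / \<eta> + 1"
    using of_int_ceiling_le_add_one[of "1 / \<eta>"] assms(1,2) by (simp add: h_def)
  then have "real h * \<eta> \<le> 2"
    using mult_right_mono[of "real h" "1 / \<eta> + 1" \<eta>] assms by (simp add: distrib_right)
  then have "(8 * real h * \<eta>) ^ r \<le> 16 ^ r"
    using assms(1) by (intro power_mono) (auto simp: mult.commute)
  then show "(8 * real h) ^ r * \<eta> ^ r \<le> 16 ^ r" by (simp add: power_mult_distrib)
qed

theorem theorem7p1:
  fixes r :: nat
  shows "\<exists>c::real. c > 0 \<and>
    (\<forall>(\<mu>::rat) (\<eta>::real). 0 < \<mu> \<and> \<mu> < 1 \<and> real_of_rat \<mu> < \<eta> \<and> \<eta> < 1 \<longrightarrow>
      (\<exists>A. solves_in_poly_time A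
         (\<lambda>H x. is_instance r H \<and> bias H = \<mu> \<and> enc_instance H x)
         (\<lambda>H y. \<exists>\<pi>. y = enc_labeling (num_verts H) \<pi> \<and>
            real_of_rat (rel_weight H \<pi>) \<le> real_of_rat \<mu> * (1 + \<eta>) \<and>
            Val H \<pi> \<ge> c * (\<eta> ^ r * alpha_uw \<mu> r) * Val_le \<mu> H)))"
proof (intro exI[of _ "1 / (4 * 16 ^ r)"] conjI allI impI)
  fix \<mu> :: rat and \<eta> :: real
  assume hyp: "0 < \<mu> \<and> \<mu> < 1 \<and> real_of_rat \<mu> < \<eta> \<and> \<eta> < 1"
  \<comment> \<open>\<open>16 ^ r\<close> bounds \<open>(8 * h * \<eta>) ^ r\<close>. One factor 2
    is for the halved potential, the other for the unattained supremum.\<close>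
  let ?c = "1 / (4 * 16 ^ r) :: real"
  have \<mu>: "0 < \<mu>" "\<mu> < 1" and "real_of_rat \<mu> > 0" and \<eta>: "\<eta> < 1" using hyp by auto
  then have \<eta>0: "0 < \<eta>" using hyp by linarith
  define a b where "a = fst (rat_pair \<mu>)" and "b = snd (rat_pair \<mu>)"
  have b: "b > 0" and \<mu>_eq: "\<mu> = of_nat a / of_nat b"
    using rat_pair_nonneg[of \<mu>] \<mu> by (auto simp: a_def b_def)
  have a: "a > 0" using \<mu>(1) \<mu>_eq by (cases "a = 0") auto
  have "a \<le> b" using \<mu>(2) b unfolding \<mu>_eq by simp
  define h where "h = nat \<lceil>1 / \<eta>\<rceil>"
  have h: "h > 0" "1 \<le> real h * \<eta>" "(8 * real h) ^ r * \<eta> ^ r \<le> 16 ^ r"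
    unfolding h_def using eta_power_bound[OF \<eta>0 \<eta>] by auto
  have alpha: "0 \<le> alpha_uw \<mu> r" "alpha_uw \<mu> r \<le> 1"
    using alpha_uw_bounds[of \<mu>] \<mu> by auto
  \<comment> \<open>This settles total weight 0, where the all-one labeling is optimal and only a
    factor at most 1 is needed.\<close>
  have factor: "?c * (\<eta> ^ r * alpha_uw \<mu> r) \<le> 1"
  proof -
    have "\<eta> ^ r * alpha_uw \<mu> r \<le> 1"
      using \<eta>0 \<eta> alpha by (intro mult_le_one power_le_one) auto
    moreover have "1 \<le> 4 * (16::real) ^ r"
      using one_le_power[of "16::real" r] by linarith
    ultimately show "?c * (\<eta> ^ r * alpha_uw \<mu> r) \<le> 1" by (simp add: divide_le_eq)
  qed
  obtain B \<alpha> where B: "approximates_DkSH B \<mu> r \<alpha>" "0 \<le> \<alpha>" "alpha_uw \<mu> r \<le> 2 * \<alpha>"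
    using alpha_uw_approximated[of \<mu> r] \<mu> by auto
  from weighted_algorithm[OF B(1)[unfolded \<mu>_eq] a b h(1)]
  obtain A and p :: "nat poly" where A: "\<forall>ws es q. (\<forall>e\<in>set es. valid_edge (length ws) e \<and> length e = r) \<longrightarrow>
      (\<exists>t bits. exec A (encode (ws, es, q :: nat \<times> nat)) t (encode (decode a b h ws es bits)) \<and>
        t \<le> poly p (esize (ws, es, q)) \<and> good_answer r a b \<alpha> ws es bits)"
    by (elim exE)
  have "\<exists>t y. exec A x t y \<and> t \<le> poly p (tree_size x) \<and>
      (\<exists>\<pi>. y = enc_labeling (num_verts H) \<pi> \<and>
        real_of_rat (rel_weight H \<pi>) \<le> real_of_rat \<mu> * (1 + \<eta>) \<and>
        ?c * (\<eta> ^ r * alpha_uw \<mu> r) * Val_le \<mu> H \<le> Val H \<pi>)"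
    if H: "is_instance r H" "bias H = \<mu>" "enc_instance H x" for H x
  proof -
    define ws where "ws = map (\<lambda>i. rat_pair (weight H i)) [0..<num_verts H]"
    have len: "length ws = num_verts H" by (simp add: ws_def)
    from H(3) obtain es where es: "mset (map set es) = hyperedges H" "\<forall>e\<in>set es. distinct e"
      and x: "x = Node (enc_list (map (\<lambda>i. enc_rat (weight H i)) [0..<num_verts H]))
        (Node (enc_list (map (\<lambda>e. enc_list (map Atom e)) es)) (enc_rat (bias H)))"
      unfolding enc_instance_def enc_edges_def by blast
    have x': "x = encode (ws, es, rat_pair \<mu>)"
      unfolding x ws_def
      by (simp add: encode_edges enc_rat_eq H(2)) (simp add: encode_list_def comp_def)
    have valid: "valid_edge (length ws) e \<and> length e = r" if "e \<in> set es" for e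
    proof -
      have "set e \<in># hyperedges H" using that by (auto simp flip: es(1))
      then have "set e \<subseteq> {..<num_verts H}" "card (set e) = r"
        using H(1) by (auto simp: is_instance_def uniform_def)
      then show ?thesis
        using es(2) that by (auto simp: valid_edge_def len distinct_card)
    qed
    have nonneg: "\<forall>i<num_verts H. 0 \<le> weight H i"
      using H(1) by (simp add: is_instance_def)
    note rw = rel_weight_int_weights[OF ws_def nonneg]
    note Val = Val_eq_length_filter[OF es(1)[symmetric]]
    obtain t bits where t: "exec A x t (encode (decode a b h ws es bits))" "t \<le> poly p (tree_size x)"
      and bits: "good_answer r a b \<alpha> ws es bits"
      using A[rule_format, of es ws "rat_pair \<mu>"] valid unfolding x' by blast
    obtain \<sigma> where \<sigma>: "rel_weight H \<sigma> \<le> \<mu>" "Val_le \<mu> H = Val H \<sigma>"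
      using Val_le_attained[of \<mu> H] \<mu>(1) by auto
    have "\<exists>\<pi>. encode (decode a b h ws es bits) = enc_labeling (num_verts H) \<pi> \<and>
        real_of_rat (rel_weight H \<pi>) \<le> real_of_rat \<mu> * (1 + \<eta>) \<and>
        ?c * (\<eta> ^ r * alpha_uw \<mu> r) * Val_le \<mu> H \<le> Val H \<pi>"
    proof (cases "sum_list (int_weights ws) = 0")
      case True
      have "decode a b h ws es bits = map (\<lambda>i. if True then 1 else 0) [0..<num_verts H]"
        unfolding decode_def if_P[OF True] by (simp add: ws_def comp_def)
      then have "encode (decode a b h ws es bits) = enc_labeling (num_verts H) (\<lambda>_. True)"
        by (simp only: enc_labeling_eq)
      moreover have "real_of_rat (rel_weight H (\<lambda>_. True)) \<le> real_of_rat \<mu> * (1 + \<eta>)"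
        unfolding rw True using \<eta>0 \<mu>(1) by simp
      moreover have "?c * (\<eta> ^ r * alpha_uw \<mu> r) * Val_le \<mu> H \<le> 1 * Val H \<sigma>"
        unfolding \<sigma>(2) using factor by (rule mult_right_mono) (rule Val_nonneg)
      then have "?c * (\<eta> ^ r * alpha_uw \<mu> r) * Val_le \<mu> H \<le> Val H (\<lambda>_. True)"
        by (rule order_trans) (simp add: Val divide_right_mono)
      ultimately show ?thesis by blast
    next
      case False
      then interpret weighted_instance ws es a b h r
        using a b h(1) valid by unfold_locales (simp_all only: neq0_conv)
      have n: "n = num_verts H" by (simp add: n_def len)
      have rw': "rel_weight H \<pi> = of_nat (sum wt {i. i < n \<and> \<pi> i}) / of_nat W" for \<pi>
        unfolding rw n W_def wt_def ..
      have "sum_list (int_weights ws) > 0" by (rule W_pos)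
      \<comment> \<open>The obtained variable \<open>bits\<close> hides the locale constant of that
        name, hence the qualified name.\<close>
      with bits obtain S where S: "S \<subseteq> {..<Q}" "card S = 2 * a * n"
        "bits = weighted_instance.bits ws b S"
        "Val (cloud_graph r a b ws es) (\<lambda>i. i \<in> S) \<ge> \<alpha> * DkSH_opt (cloud_graph r a b ws es) (2 * a * n)"
        unfolding good_answer_def Q_def n_def bits_def by blast
      let ?\<pi> = "out S"
      have enc: "encode (decode a b h ws es bits) = enc_labeling (num_verts H) ?\<pi>"
        unfolding S(3) enc_labeling_eq n[symmetric] decode_eq ..
      have Wr: "real W > 0" using W_gt_0 by simp
      have "real h * (real b * real (sum wt {i. i < n \<and> ?\<pi> i})) \<le> (real h + 1) * (real a * real W)"
        using output_weight[OF S(1,2)] unfolding of_nat_le_iff[where 'a = real, symmetric]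
        by (simp add: algebra_simps)
      \<comment> \<open>\<open>1 \<le> h * \<eta>\<close> turns h + 1 into at most h(1 + \<eta>), so
        that h cancels.\<close>
      also have "\<dots> \<le> real h * ((1 + \<eta>) * (real a * real W))"
        using h(2) mult_right_mono[of "real h + 1" "real h * (1 + \<eta>)" "real a * real W"]
        by (simp add: algebra_simps)
      finally have "real b * real (sum wt {i. i < n \<and> ?\<pi> i}) \<le> (1 + \<eta>) * (real a * real W)"
        using h(1) by (simp only: mult_le_cancel_left_pos of_nat_0_less_iff)
      then have weight: "real_of_rat (rel_weight H ?\<pi>) \<le> real_of_rat \<mu> * (1 + \<eta>)"
        using Wr b unfolding rw' \<mu>_eq by (simp add: of_rat_divide field_simps del: of_nat_sum)
      have "of_nat (b * sum wt {i. i < n \<and> \<sigma> i}) \<le> (of_nat (a * W) :: rat)"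
        using \<sigma>(1) W_gt_0 b unfolding rw' \<mu>_eq by (simp add: field_simps)
      then have \<sigma>_le: "b * sum wt {i. i < n \<and> \<sigma> i} \<le> a * W" by (simp only: of_nat_le_iff)
      let ?N = "real (length (filter (\<lambda>e. \<forall>i\<in>set e. \<sigma> i) es))"
      let ?M = "real (length (filter (\<lambda>e. \<forall>i\<in>set e. ?\<pi> i) es))"
      have main: "\<alpha> * ?N \<le> 2 * (8 * real h) ^ r * ?M"
        by (rule approximation_transfer[OF S(1,2) \<open>a \<le> b\<close> B(2) S(4) \<sigma>_le])
      have "\<eta> ^ r * alpha_uw \<mu> r * ?N \<le> \<eta> ^ r * (2 * \<alpha>) * ?N"
        using B(3) \<eta>0 by (intro mult_right_mono mult_left_mono) auto
      also have "\<dots> = 2 * \<eta> ^ r * (\<alpha> * ?N)" by simp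
      also have "\<dots> \<le> 2 * \<eta> ^ r * (2 * (8 * real h) ^ r * ?M)"
        using main \<eta>0 by (intro mult_left_mono) auto
      also have "\<dots> = ((8 * real h) ^ r * \<eta> ^ r) * (4 * ?M)" by simp
      also have "\<dots> \<le> 16 ^ r * (4 * ?M)"
        using h(3) by (intro mult_right_mono) auto
      finally have "?c * (\<eta> ^ r * alpha_uw \<mu> r) * ?N \<le> ?M"
        by (simp add: field_simps)
      then have "?c * (\<eta> ^ r * alpha_uw \<mu> r) * Val_le \<mu> H \<le> Val H ?\<pi>"
        unfolding \<sigma>(2) Val times_divide_eq_right by (rule divide_right_mono) simp
      with enc weight show ?thesis by blast
    qed
    with t show ?thesis by blast
  qed
  then show "\<exists>A. solves_in_poly_time A (\<lambda>H x. is_instance r H \<and> bias H = \<mu> \<and> enc_instance H x)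
      (\<lambda>H y. \<exists>\<pi>. y = enc_labeling (num_verts H) \<pi> \<and>
        real_of_rat (rel_weight H \<pi>) \<le> real_of_rat \<mu> * (1 + \<eta>) \<and>
        ?c * (\<eta> ^ r * alpha_uw \<mu> r) * Val_le \<mu> H \<le> Val H \<pi>)"
    unfolding solves_in_poly_time_def by blast
qed simp

end
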